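(* Let $\mathcal{L}$ be the category of feudal fusion rules and graded homomorphisms, and let $\mathcal{H}$ be the category of group homomorphisms $u\colon S\to G$ with $|\mathrm{coker}\,u|=2$ and $\ker u$ finite (subject to the technical conventions given in the context). Then the functors $\Phi\colon\mathcal{H}\to\mathcal{L}$ and $\Gamma\colon\mathcal{L}\to\mathcal{H}$ described in the context are mutually inverse isomorphisms of categories; in particular $\mathcal{L}$ is isomorphic to $\mathcal{H}$.
   Context: **Fusion rules.** A multiset over a set $L$ is a function $X\in\mathbb{N}^L$ ($0\in\mathbb N$), with value $\langle X,x\rangle$ at $x$; it is finite if it has finite support. A multimagma is a set $L$ with an operation $\ast\colon L\times L\to\mathbb{N}^L$, also written $(x,y)\mapsto xy$; it is locally finite if every $xy$ is finite. For finite $X,Y\in\mathbb{N}^L$ put $\langle XY,z\rangle=\sum_{x,y\in L}\langle X,x\rangle\langle Y,y\rangle\langle xy,z\rangle$. Subsets of a set are identified with their indicator functions, and an element $x$ with the singleton $\{x\}$. A fusion rule is a locally finite multimagma $L$ such that $(xy)z=x(yz)$ for all $x,y,z$; there is $1\in L$ with $1x=x1=x$ for all $x$; and for every $x$ there is $\bar x\in L$ with $\langle xy,1\rangle=\langle yx,1\rangle=\delta_{y,\bar x}$ for all $y\in L$. Groups are precisely the fusion rules with single-valued fusion, and then $\bar a=a^{-1}$. For a multiset $X$ let $\lfloor X\rfloor=\{x:\langle X,x\rangle>0\}$, and let $\lfloor L\rfloor$ be the multimagma on the same elements with operation $(x,y)\mapsto\lfloor xy\rfloor$; $L$ is multiplicity-free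 if $L=\lfloor L\rfloor$. A map $f\colon L\to L'$ of multiplicity-free multimagmas is a homomorphism if $f(xy)\subseteq f(x)f(y)$ for all $x,y$. For a group $G$, a $G$-grading on a fusion rule $L$ is a surjective homomorphism $\lfloor L\rfloor\to G$. **Adjoint subrule and universal grading.** A subset $T\ni 1$ of a fusion rule $L$ is a subrule if $z\in T$ whenever $\bar z\in T$ or $z\in\lfloor xy\rfloor$ for some $x,y\in T$. The adjoint subrule $L_{\mathrm{ad}}$ is the smallest subrule containing $\lfloor x\bar x\rfloor$ for all $x\in L$. The left cosets of a subrule $T$ are the subsets $\lfloor xT\rfloor$, $x\in L$; the set $L/T$ of them is a multimagma with $\langle X\ast_T Y,Z\rangle=\max\{\langle xy,z\rangle: x\in X,y\in Y,z\in Z\}$. It is known that $\lfloor L/L_{\mathrm{ad}}\rfloor$ is a group whose elements partition $L$; it is called the universal grading group, and the projection $\lfloor L\rfloor\to\lfloor L/L_{\mathrm{ad}}\rfloor$ is the universal grading. **Feudal fusion rules.** Let $\mathbb{Z}_2=\{\pm1\}$. A fusion rule is feudal if it is equipped with a $\mathbb{Z}_2$-grading $\gamma$ such that $\gamma^{-1}(1)$ is a group. Elements of $\gamma^{-1}(1)$ are serfs; elements of $\gamma^{-1}(-1)$ are lords. Feudal fusion rules are multiplicity-free; for a lord $m$ the coset $\lfloor mL_{\mathrm{ad}}\rfloor$ is the singleton $\{m\}$, identified with $m$. A graded homomorphism of feudal fusion rules is a homomorphism compatible with the $\mathbb{Z}_2$-gradings. **The category $\mathcal{H}$.** Objects: homomorphisms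 $u\colon S\to G$ of arbitrary groups with $|\mathrm{coker}\,u|=2$ and $\ker u$ finite, subject to the technical conditions $S\cap(G\setminus\mathrm{im}\,u)=\emptyset$ and $\mathrm{im}\,u=S/\ker u$, the latter meaning that $u$ corestricted to its image is the quotient projection $S\to S/\ker u$. A morphism from $u\colon S\to G$ to $\tilde u\colon\tilde S\to\tilde G$ is a pair of homomorphisms $h_0\colon S\to\tilde S$, $h_1\colon G\to\tilde G$ with $h_1u=\tilde uh_0$ and $h_1(G\setminus\mathrm{im}\,u)\subseteq\tilde G\setminus\mathrm{im}\,\tilde u$. **The functor $\Phi\colon\mathcal{H}\to\mathcal{L}$.** For $H=(u\colon S\to G)$, $\Phi H$ is the feudal fusion rule with serfs $S$ and lords $M=G\setminus\mathrm{im}\,u$, with fusion, for $a,b\in S$ and $m,l\in M$: $a\ast b=ab$, $a\ast m=u(a)m$, $m\ast a=mu(a)$, $m\ast l=u^{-1}(ml)$. For a morphism $(h_0,h_1)$, $\Phi(h_0,h_1)$ agrees with $h_0$ on $S$ and with $h_1$ on $M$. **The functor $\Gamma\colon\mathcal{L}\to\mathcal{H}$.** For a feudal fusion rule $L$, $\Gamma L=(u\colon S\to G)$ where $S$ is the group of serfs, $G$ is the universal grading group of $L$, and $u$ is the restriction to $S$ of the universal grading. For a graded homomorphism $t\colon L\to\tilde L$, $\Gamma t=(h_0,h_1)$, where $h_0$ is the restriction of $t$ to serfs and $h_1$ is the map of universal grading groups induced by $t$. *)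

theory Defs
  imports "HOL-Algebra.Coset"
begin

section \<open>Multimagmas and fusion rules\<close>

text \<open>
  A multiset over \<open>L\<close> is a function into \<^typ>\<open>nat\<close>; multisets over a carrier are extended by zero
  outside it. The field \<open>fusion L x y z\<close> is the multiplicity of \<open>z\<close> in \<open>xy\<close>.
\<close>

record 'a multimagma = "'a partial_object" +
  fusion :: "'a \<Rightarrow> 'a \<Rightarrow> 'a \<Rightarrow> nat"

definition floor_set :: "('a \<Rightarrow> nat) \<Rightarrow> 'a set" where
  "floor_set X = {x. X x > 0}"

definition ind :: "'a set \<Rightarrow> 'a \<Rightarrow> nat" where
  "ind A x = (if x \<in> A then 1 else 0)"

definition multimagma :: "('a, 'b) multimagma_scheme \<Rightarrow> bool" where
  "multimagma L \<longleftrightarrow>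
     (\<forall>x y z. fusion L x y z > 0 \<longrightarrow> x \<in> carrier L \<and> y \<in> carrier L \<and> z \<in> carrier L)"

definition locally_finite :: "('a, 'b) multimagma_scheme \<Rightarrow> bool" where
  "locally_finite L \<longleftrightarrow> (\<forall>x\<in>carrier L. \<forall>y\<in>carrier L. finite (floor_set (fusion L x y)))"

text \<open>
  The sum is over the supports, not over the carrier: a sum over an infinite set is \<open>0\<close>.
\<close>

definition mprod :: "('a, 'b) multimagma_scheme \<Rightarrow> ('a \<Rightarrow> nat) \<Rightarrow> ('a \<Rightarrow> nat) \<Rightarrow> 'a \<Rightarrow> nat" where
  "mprod L X Y z = (\<Sum>x\<in>floor_set X. \<Sum>y\<in>floor_set Y. X x * Y y * fusion L x y z)"

definition is_unit_of :: "('a, 'b) multimagma_scheme \<Rightarrow> 'a \<Rightarrow> bool" where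
  "is_unit_of L e \<longleftrightarrow> e \<in> carrier L \<and>
     (\<forall>x\<in>carrier L. fusion L e x = ind {x} \<and> fusion L x e = ind {x})"

definition unit_of :: "('a, 'b) multimagma_scheme \<Rightarrow> 'a" where
  "unit_of L = (THE e. is_unit_of L e)"

definition is_conj_of :: "('a, 'b) multimagma_scheme \<Rightarrow> 'a \<Rightarrow> 'a \<Rightarrow> 'a \<Rightarrow> bool" where
  "is_conj_of L e x x' \<longleftrightarrow> x' \<in> carrier L \<and>
     (\<forall>y\<in>carrier L. fusion L x y e = (if y = x' then 1 else 0) \<and>
                    fusion L y x e = (if y = x' then 1 else 0))"

definition conj_of :: "('a, 'b) multimagma_scheme \<Rightarrow> 'a \<Rightarrow> 'a" where
  "conj_of L x = (THE x'. is_conj_of L (unit_of L) x x')"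

definition fusion_rule :: "('a, 'b) multimagma_scheme \<Rightarrow> bool" where
  "fusion_rule L \<longleftrightarrow> multimagma L \<and> locally_finite L \<and>
     (\<forall>x\<in>carrier L. \<forall>y\<in>carrier L. \<forall>z\<in>carrier L.
        mprod L (fusion L x y) (ind {z}) = mprod L (ind {x}) (fusion L y z)) \<and>
     (\<exists>e. is_unit_of L e \<and> (\<forall>x\<in>carrier L. \<exists>x'. is_conj_of L e x x'))"

definition floor_mm :: "('a, 'b) multimagma_scheme \<Rightarrow> 'a multimagma" where
  "floor_mm L = \<lparr>carrier = carrier L, fusion = (\<lambda>x y. ind (floor_set (fusion L x y)))\<rparr>"

text \<open>
  Homomorphisms are used only between multiplicity-free multimagmas, whose products are identified
  with their supports.
\<close>

definition mm_hom ::
  "('a, 'b) multimagma_scheme \<Rightarrow> ('c, 'd) multimagma_scheme \<Rightarrow> ('a \<Rightarrow> 'c) set" where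
  "mm_hom L L' = {f \<in> carrier L \<rightarrow> carrier L'. \<forall>x\<in>carrier L. \<forall>y\<in>carrier L.
     f ` floor_set (fusion L x y) \<subseteq> floor_set (fusion L' (f x) (f y))}"

definition mm_of_group :: "('a, 'b) monoid_scheme \<Rightarrow> 'a multimagma" where
  "mm_of_group G = \<lparr>carrier = carrier G,
     fusion = (\<lambda>x y. if x \<in> carrier G \<and> y \<in> carrier G then ind {x \<otimes>\<^bsub>G\<^esub> y} else ind {})\<rparr>"

text \<open>
  The group underlying a single-valued fusion rule. Its multiplication is fixed to
  \<^const>\<open>undefined\<close> off the carrier, so that groups can be compared by equality of records.
\<close>

definition group_of_mm :: "('a, 'b) multimagma_scheme \<Rightarrow> 'a monoid" where
  "group_of_mm L = \<lparr>carrier = carrier L,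
     mult = (\<lambda>x y. if x \<in> carrier L \<and> y \<in> carrier L
                   then THE z. z \<in> floor_set (fusion L x y) else undefined),
     one = unit_of L\<rparr>"

definition grading ::
  "('g, 'c) monoid_scheme \<Rightarrow> ('a, 'b) multimagma_scheme \<Rightarrow> ('a \<Rightarrow> 'g) \<Rightarrow> bool" where
  "grading G L f \<longleftrightarrow> f \<in> mm_hom (floor_mm L) (mm_of_group G) \<and> f ` carrier L = carrier G"

section \<open>Adjoint subrule and universal grading\<close>

definition subrule :: "('a, 'b) multimagma_scheme \<Rightarrow> 'a set \<Rightarrow> bool" where
  "subrule L T \<longleftrightarrow> T \<subseteq> carrier L \<and> unit_of L \<in> T \<and>
     (\<forall>z\<in>carrier L. conj_of L z \<in> T \<or> (\<exists>x\<in>T. \<exists>y\<in>T. z \<in> floor_set (fusion L x y)) \<longrightarrow> z \<in> T)"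

definition adjoint_subrule :: "('a, 'b) multimagma_scheme \<Rightarrow> 'a set" where
  "adjoint_subrule L =
     \<Inter>{T. subrule L T \<and> (\<forall>x\<in>carrier L. floor_set (fusion L x (conj_of L x)) \<subseteq> T)}"

definition left_coset :: "('a, 'b) multimagma_scheme \<Rightarrow> 'a set \<Rightarrow> 'a \<Rightarrow> 'a set" where
  "left_coset L T x = (\<Union>t\<in>T. floor_set (fusion L x t))"

text \<open>
  The multimagma \<open>L/T\<close>. The maximum is unspecified when the multiplicities are unbounded; in the
  multiplicity-free case they lie in \<open>{0, 1}\<close>.
\<close>

definition coset_mm :: "('a, 'b) multimagma_scheme \<Rightarrow> 'a set \<Rightarrow> 'a set multimagma" where
  "coset_mm L T = (let C = left_coset L T ` carrier L in
     \<lparr>carrier = C,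
      fusion = (\<lambda>X Y Z. if X \<in> C \<and> Y \<in> C \<and> Z \<in> C
                        then Max {fusion L x y z | x y z. x \<in> X \<and> y \<in> Y \<and> z \<in> Z} else 0)\<rparr>)"

definition univ_grading_group :: "('a, 'b) multimagma_scheme \<Rightarrow> 'a set monoid" where
  "univ_grading_group L = group_of_mm (floor_mm (coset_mm L (adjoint_subrule L)))"

text \<open>
  The cosets of the adjoint subrule partition \<open>L\<close>, and \<open>x\<close> lies in its own coset, since \<open>1\<close> lies in
  the subrule; so the projection is the following map.
\<close>

definition univ_grading :: "('a, 'b) multimagma_scheme \<Rightarrow> 'a \<Rightarrow> 'a set" where
  "univ_grading L = (\<lambda>x\<in>carrier L. left_coset L (adjoint_subrule L) x)"

section \<open>Feudal fusion rules\<close>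

definition Z2 :: "int monoid" where
  "Z2 = \<lparr>carrier = {1, -1}, mult = (*), one = 1\<rparr>"

record 'a feudal = "'a multimagma" +
  grade :: "'a \<Rightarrow> int"

definition serfs :: "('a, 'b) feudal_scheme \<Rightarrow> 'a set" where
  "serfs L = {x \<in> carrier L. grade L x = 1}"

definition lords :: "('a, 'b) feudal_scheme \<Rightarrow> 'a set" where
  "lords L = {x \<in> carrier L. grade L x = -1}"

definition sub_mm :: "('a, 'b) multimagma_scheme \<Rightarrow> 'a set \<Rightarrow> 'a multimagma" where
  "sub_mm L T = \<lparr>carrier = T,
     fusion = (\<lambda>x y z. if x \<in> T \<and> y \<in> T \<and> z \<in> T then fusion L x y z else 0)\<rparr>"

definition feudal_rule :: "'a feudal \<Rightarrow> bool" where
  "feudal_rule L \<longleftrightarrow> fusion_rule L \<and>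
     grading Z2 L (grade L) \<and> grade L \<in> extensional (carrier L) \<and>
     (\<exists>S :: 'a monoid. group S \<and> sub_mm L (serfs L) = mm_of_group S)"

definition serf_group :: "('a, 'b) feudal_scheme \<Rightarrow> 'a monoid" where
  "serf_group L = group_of_mm (sub_mm L (serfs L))"

definition graded_hom :: "'a feudal \<Rightarrow> 'a feudal \<Rightarrow> ('a \<Rightarrow> 'a) set" where
  "graded_hom L L' = {t \<in> mm_hom L L' \<inter> extensional (carrier L).
     \<forall>x\<in>carrier L. grade L' (t x) = grade L x}"

section \<open>Categories and functors\<close>

text \<open>
  A category is given by its objects and a family of hom-sets; \<open>Comp X Y Z g f\<close> is the composite of
  \<open>f : X \<rightarrow> Y\<close> and \<open>g : Y \<rightarrow> Z\<close>.
\<close>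

record ('o, 'm) cat =
  Ob :: "'o set"
  Hom :: "'o \<Rightarrow> 'o \<Rightarrow> 'm set"
  Ident :: "'o \<Rightarrow> 'm"
  Comp :: "'o \<Rightarrow> 'o \<Rightarrow> 'o \<Rightarrow> 'm \<Rightarrow> 'm \<Rightarrow> 'm"

definition category :: "('o, 'm) cat \<Rightarrow> bool" where
  "category C \<longleftrightarrow>
     (\<forall>X\<in>Ob C. Ident C X \<in> Hom C X X) \<and>
     (\<forall>X\<in>Ob C. \<forall>Y\<in>Ob C. \<forall>Z\<in>Ob C. \<forall>f\<in>Hom C X Y. \<forall>g\<in>Hom C Y Z.
        Comp C X Y Z g f \<in> Hom C X Z) \<and>
     (\<forall>X\<in>Ob C. \<forall>Y\<in>Ob C. \<forall>f\<in>Hom C X Y.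
        Comp C X X Y f (Ident C X) = f \<and> Comp C X Y Y (Ident C Y) f = f) \<and>
     (\<forall>W\<in>Ob C. \<forall>X\<in>Ob C. \<forall>Y\<in>Ob C. \<forall>Z\<in>Ob C.
        \<forall>f\<in>Hom C W X. \<forall>g\<in>Hom C X Y. \<forall>h\<in>Hom C Y Z.
        Comp C W Y Z h (Comp C W X Y g f) = Comp C W X Z (Comp C X Y Z h g) f)"

record ('o, 'm, 'p, 'n) ftor =
  on_ob :: "'o \<Rightarrow> 'p"
  on_hom :: "'o \<Rightarrow> 'o \<Rightarrow> 'm \<Rightarrow> 'n"

definition is_functor :: "('o, 'm) cat \<Rightarrow> ('p, 'n) cat \<Rightarrow> ('o, 'm, 'p, 'n) ftor \<Rightarrow> bool" where
  "is_functor C D F \<longleftrightarrow>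
     (\<forall>X\<in>Ob C. on_ob F X \<in> Ob D) \<and>
     (\<forall>X\<in>Ob C. \<forall>Y\<in>Ob C. \<forall>f\<in>Hom C X Y.
        on_hom F X Y f \<in> Hom D (on_ob F X) (on_ob F Y)) \<and>
     (\<forall>X\<in>Ob C. on_hom F X X (Ident C X) = Ident D (on_ob F X)) \<and>
     (\<forall>X\<in>Ob C. \<forall>Y\<in>Ob C. \<forall>Z\<in>Ob C. \<forall>f\<in>Hom C X Y. \<forall>g\<in>Hom C Y Z.
        on_hom F X Z (Comp C X Y Z g f) =
        Comp D (on_ob F X) (on_ob F Y) (on_ob F Z) (on_hom F Y Z g) (on_hom F X Y f))"

definition left_inverse ::
  "('o, 'm) cat \<Rightarrow> ('o, 'm, 'p, 'n) ftor \<Rightarrow> ('p, 'n, 'o, 'm) ftor \<Rightarrow> bool" where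
  "left_inverse C F F' \<longleftrightarrow>
     (\<forall>X\<in>Ob C. on_ob F' (on_ob F X) = X) \<and>
     (\<forall>X\<in>Ob C. \<forall>Y\<in>Ob C. \<forall>f\<in>Hom C X Y.
        on_hom F' (on_ob F X) (on_ob F Y) (on_hom F X Y f) = f)"

definition mutually_inverse_isos ::
  "('o, 'm) cat \<Rightarrow> ('p, 'n) cat \<Rightarrow> ('o, 'm, 'p, 'n) ftor \<Rightarrow> ('p, 'n, 'o, 'm) ftor \<Rightarrow> bool" where
  "mutually_inverse_isos C D F F' \<longleftrightarrow>
     is_functor C D F \<and> is_functor D C F' \<and> left_inverse C F F' \<and> left_inverse D F' F"

definition isomorphic_cats :: "('o, 'm) cat \<Rightarrow> ('p, 'n) cat \<Rightarrow> bool" where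
  "isomorphic_cats C D \<longleftrightarrow> (\<exists>F F'. mutually_inverse_isos C D F F')"

definition catL :: "('a feudal, 'a \<Rightarrow> 'a) cat" where
  "catL = \<lparr>Ob = {L. feudal_rule L}, Hom = graded_hom,
     Ident = (\<lambda>L. \<lambda>x\<in>carrier L. x),
     Comp = (\<lambda>L L' L'' g f. compose (carrier L) g f)\<rparr>"

section \<open>The category of group homomorphisms\<close>

text \<open>
  The image of \<open>u\<close> consists of cosets, that is of subsets of \<open>S\<close>, so \<open>G\<close> has elements of type
  \<^typ>\<open>'a set\<close>. An element \<open>m\<close> of the complement of the image, being identified with the singleton
  \<open>{m}\<close>, is represented by that singleton. No generality is lost, as elements may be renamed.
  The condition that \<open>S\<close> and the complement of the image are disjoint then reads \<open>m \<notin> S\<close>.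
\<close>

record 'a hobj =
  src :: "'a monoid"
  tgt :: "'a set monoid"
  hmap :: "'a \<Rightarrow> 'a set"

definition him :: "'a hobj \<Rightarrow> 'a set set" where
  "him H = hmap H ` carrier (src H)"

definition ext_mult :: "'a monoid \<Rightarrow> bool" where
  "ext_mult G \<longleftrightarrow> (\<forall>x y. x \<notin> carrier G \<or> y \<notin> carrier G \<longrightarrow> x \<otimes>\<^bsub>G\<^esub> y = undefined)"

text \<open>
  The cokernel is the set of cosets of the image (which is normal, having index two).
\<close>

definition hobject :: "'a hobj \<Rightarrow> bool" where
  "hobject H \<longleftrightarrow>
     group (src H) \<and> ext_mult (src H) \<and> group (tgt H) \<and> ext_mult (tgt H) \<and>
     hmap H \<in> hom (src H) (tgt H) \<and> hmap H \<in> extensional (carrier (src H)) \<and>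
     card (rcosets\<^bsub>tgt H\<^esub> (him H)) = 2 \<and>
     finite (kernel (src H) (tgt H) (hmap H)) \<and>
     (\<forall>X \<in> carrier (tgt H) - him H. \<exists>m. m \<notin> carrier (src H) \<and> X = {m}) \<and>
     (\<forall>a \<in> carrier (src H). hmap H a = kernel (src H) (tgt H) (hmap H) #>\<^bsub>src H\<^esub> a)"

definition hmorphisms :: "'a hobj \<Rightarrow> 'a hobj \<Rightarrow> (('a \<Rightarrow> 'a) \<times> ('a set \<Rightarrow> 'a set)) set" where
  "hmorphisms H H' = {(h0, h1).
     h0 \<in> hom (src H) (src H') \<and> h0 \<in> extensional (carrier (src H)) \<and>
     h1 \<in> hom (tgt H) (tgt H') \<and> h1 \<in> extensional (carrier (tgt H)) \<and>
     (\<forall>a\<in>carrier (src H). h1 (hmap H a) = hmap H' (h0 a)) \<and>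
     h1 ` (carrier (tgt H) - him H) \<subseteq> carrier (tgt H') - him H'}"

definition catH :: "('a hobj, ('a \<Rightarrow> 'a) \<times> ('a set \<Rightarrow> 'a set)) cat" where
  "catH = \<lparr>Ob = {H. hobject H}, Hom = hmorphisms,
     Ident = (\<lambda>H. (\<lambda>a\<in>carrier (src H). a, \<lambda>X\<in>carrier (tgt H). X)),
     Comp = (\<lambda>H H' H'' g f. (compose (carrier (src H)) (fst g) (fst f),
                             compose (carrier (tgt H)) (snd g) (snd f)))\<rparr>"

section \<open>The functors\<close>

definition hlords :: "'a hobj \<Rightarrow> 'a set" where
  "hlords H = {m. {m} \<in> carrier (tgt H) - him H}"

definition Phi_fusion :: "'a hobj \<Rightarrow> 'a \<Rightarrow> 'a \<Rightarrow> 'a \<Rightarrow> nat" where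
  "Phi_fusion H x y =
     (let S = carrier (src H); M = hlords H; u = hmap H in
      if x \<in> S \<and> y \<in> S then ind {x \<otimes>\<^bsub>src H\<^esub> y}
      else if x \<in> S \<and> y \<in> M then ind {l. {l} = u x \<otimes>\<^bsub>tgt H\<^esub> {y}}
      else if x \<in> M \<and> y \<in> S then ind {l. {l} = {x} \<otimes>\<^bsub>tgt H\<^esub> u y}
      else if x \<in> M \<and> y \<in> M then ind {a \<in> S. u a = {x} \<otimes>\<^bsub>tgt H\<^esub> {y}}
      else ind {})"

definition Phi_ob :: "'a hobj \<Rightarrow> 'a feudal" where
  "Phi_ob H = \<lparr>carrier = carrier (src H) \<union> hlords H, fusion = Phi_fusion H,
     grade = (\<lambda>x\<in>carrier (src H) \<union> hlords H. if x \<in> carrier (src H) then 1 else -1)\<rparr>"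

definition Phi_hom ::
  "'a hobj \<Rightarrow> 'a hobj \<Rightarrow> ('a \<Rightarrow> 'a) \<times> ('a set \<Rightarrow> 'a set) \<Rightarrow> 'a \<Rightarrow> 'a" where
  "Phi_hom H H' h = (\<lambda>x\<in>carrier (src H) \<union> hlords H.
     if x \<in> carrier (src H) then fst h x else the_elem (snd h {x}))"

definition Phi :: "('a hobj, ('a \<Rightarrow> 'a) \<times> ('a set \<Rightarrow> 'a set), 'a feudal, 'a \<Rightarrow> 'a) ftor" where
  "Phi = \<lparr>on_ob = Phi_ob, on_hom = Phi_hom\<rparr>"

definition Gamma_ob :: "'a feudal \<Rightarrow> 'a hobj" where
  "Gamma_ob L = \<lparr>src = serf_group L, tgt = univ_grading_group L,
     hmap = restrict (univ_grading L) (serfs L)\<rparr>"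

text \<open>
  The induced map sends the coset of \<open>x\<close> to the coset of \<open>t x\<close>.
\<close>

definition Gamma_hom ::
  "'a feudal \<Rightarrow> 'a feudal \<Rightarrow> ('a \<Rightarrow> 'a) \<Rightarrow> ('a \<Rightarrow> 'a) \<times> ('a set \<Rightarrow> 'a set)" where
  "Gamma_hom L L' t =
     (restrict t (serfs L),
      \<lambda>X\<in>carrier (univ_grading_group L). THE Y. \<forall>x\<in>X. univ_grading L' (t x) = Y)"

definition Gamma :: "('a feudal, 'a \<Rightarrow> 'a, 'a hobj, ('a \<Rightarrow> 'a) \<times> ('a set \<Rightarrow> 'a set)) ftor" where
  "Gamma = \<lparr>on_ob = Gamma_ob, on_hom = Gamma_hom\<rparr>"

end

theory Submission
  imports Defs
begin

text \<open>
  Everything rests on one map. For an object \<open>u: S \<rightarrow> G\<close> let \<open>p: S \<union> M \<rightarrow> G\<close> be \<open>u\<close> on the serfs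
  \<open>S\<close> and the inclusion on the lords \<open>M = G - im u\<close>. Since \<open>im u = S/ker u\<close> and a lord \<open>m\<close> is the
  element \<open>{m}\<close> of \<open>G\<close>, every element of \<open>G\<close> is, as a set, its own fibre under \<open>p\<close>. The fusion of
  \<open>\<Phi> u\<close> therefore reads \<open>xy = p(x) p(y)\<close> as soon as a lord is involved, and is the product of \<open>S\<close>
  otherwise (\<open>fusion_L\<close>). With this formula the axioms of a fusion rule follow from the group laws of
  \<open>G\<close>; only associativity needs multiplicities, and the two bracketings of three lords both produce
  each result \<open>|ker u|\<close> times (\<open>card_products_assoc\<close>).

  For a lord \<open>m\<close> the product of \<open>m\<close> and its conjugate is \<open>u\<^sup>-\<^sup>1(1) = ker u\<close>, so the adjoint
  subrule is \<open>ker u\<close>, its cosets are the fibres of \<open>p\<close>, the universal grading group is \<open>G\<close> and the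
  universal grading is \<open>p\<close>. Hence \<open>\<Gamma> (\<Phi> u) = u\<close> (\<open>Gamma_Phi_ob\<close>). A graded homomorphism \<open>t\<close> between
  two such rules satisfies \<open>p'(t x) = h\<^sub>1 (p x)\<close> for a unique homomorphism \<open>h\<^sub>1\<close> of the groups \<open>G\<close>,
  which is the second component of \<open>\<Gamma> t\<close>. As \<open>p'\<close> is injective on lords, \<open>t\<close> can be recovered from
  its restriction to the serfs and \<open>h\<^sub>1\<close>, so \<open>\<Phi>\<close> is bijective on morphisms
  (\<open>Phi_Gamma_hom\<close>, \<open>Gamma_Phi_hom\<close>).

  It remains that every feudal rule is some \<open>\<Phi> u\<close> (\<open>Phi_serf_hom\<close>). A serf is invertible, so
  multiplication by a serf is single-valued, and the serfs act on the lords from both sides. Both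
  actions are transitive and they commute, so all lords have the same stabilizer \<open>K\<close> on either side,
  a normal subgroup of the serfs. It is the product of any lord with its conjugate, hence finite. The cosets of \<open>K\<close>
  form a group \<open>G\<close> in which each lord is a coset of its own, and \<open>u\<close> maps a serf to its coset.

  Finally, a functor that is bijective on objects and on all sets of morphisms is an isomorphism, and
  its inverse maps form a functor (\<open>mutually_inverse_isosI\<close>); so the functor laws of \<open>\<Gamma>\<close> come from
  those of \<open>\<Phi>\<close>.
\<close>

section \<open>Indicator multisets, units and conjugates\<close>

lemma floor_set_ind [simp]: "floor_set (ind A) = A"
  by (auto simp: floor_set_def ind_def)

lemma ind_eq_iff [simp]: "ind A = ind B \<longleftrightarrow> A = B"
  by (metis floor_set_ind)

lemma ind_floor_set: "(\<And>z. X z \<le> 1) \<Longrightarrow> ind (floor_set X) = X"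
proof (rule ext)
  show "ind (floor_set X) z = X z" if "\<And>z. X z \<le> 1" for z
    using that[of z] by (auto simp: floor_set_def ind_def)
qed

lemma sum_ind_eq_card:
  assumes "finite A"
  shows "(\<Sum>w\<in>A. ind A w * ind (B w) v) = card {w \<in> A. v \<in> B w}"
proof -
  have "(\<Sum>w\<in>A. ind A w * ind (B w) v) = (\<Sum>w\<in>A. if v \<in> B w then 1 else 0)"
    by (rule sum.cong) (simp_all add: ind_def)
  also have "\<dots> = card {w \<in> A. v \<in> B w}"
    using assms by (simp add: sum.If_cases Int_def)
  finally show ?thesis .
qed

lemma sum_of_positives_eq_1:
  fixes f :: "'a \<Rightarrow> nat"
  assumes "finite A" "A \<noteq> {}" "\<And>x. x \<in> A \<Longrightarrow> f x > 0" "sum f A = 1"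
  obtains x where "A = {x}"
proof -
  have "card A \<le> sum f A"
    using sum_mono[of A "\<lambda>_. 1" f] assms(3) by (simp add: Suc_leI)
  moreover have "card A > 0" using assms(1,2) by (simp add: card_gt_0_iff)
  ultimately have "card A = 1" using assms(4) by simp
  then show thesis using that card_1_singletonE by metis
qed

lemma mprod_ind_right: "mprod L X (ind {z}) v = (\<Sum>w\<in>floor_set X. X w * fusion L w z v)"
  by (simp add: mprod_def ind_def)

lemma mprod_ind_left: "mprod L (ind {x}) Y v = (\<Sum>w\<in>floor_set Y. Y w * fusion L x w v)"
  by (simp add: mprod_def ind_def)

lemma unit_of_eq:
  assumes "is_unit_of L e"
  shows "unit_of L = e"
  unfolding unit_of_def
proof (rule the_equality)
  show "e' = e" if "is_unit_of L e'" for e'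
  proof -
    have "fusion L e e' = ind {e'}" "fusion L e e' = ind {e}"
      using that assms unfolding is_unit_of_def by blast+
    then have "ind {e'} = ind {e}" by metis
    then show ?thesis by simp
  qed
qed (fact assms)

lemma conj_of_eq:
  assumes "is_conj_of L (unit_of L) x x'"
  shows "conj_of L x = x'"
  unfolding conj_of_def
proof (rule the_equality)
  fix y assume "is_conj_of L (unit_of L) x y"
  then have "y \<in> carrier L" and "fusion L x y (unit_of L) = 1"
    by (simp_all add: is_conj_of_def)
  moreover have "fusion L x y (unit_of L) = (if y = x' then 1 else 0)"
    using assms \<open>y \<in> carrier L\<close> by (simp add: is_conj_of_def)
  ultimately show "y = x'" by presburger
qed (fact assms)

section \<open>Groups as multimagmas\<close>

lemma is_unit_of_mm_of_group:
  assumes "group G"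
  shows "is_unit_of (mm_of_group G) \<one>\<^bsub>G\<^esub>"
proof -
  interpret group G by fact
  show ?thesis by (simp add: is_unit_of_def mm_of_group_def)
qed

lemma
  assumes "group G"
  shows carrier_group_of_mm_of_group: "carrier (group_of_mm (mm_of_group G)) = carrier G"
    and one_group_of_mm_of_group: "\<one>\<^bsub>group_of_mm (mm_of_group G)\<^esub> = \<one>\<^bsub>G\<^esub>"
    and mult_group_of_mm_of_group:
      "x \<otimes>\<^bsub>group_of_mm (mm_of_group G)\<^esub> y =
       (if x \<in> carrier G \<and> y \<in> carrier G then x \<otimes>\<^bsub>G\<^esub> y else undefined)"
  by (simp_all add: group_of_mm_def unit_of_eq[OF is_unit_of_mm_of_group[OF assms]])
    (auto simp add: mm_of_group_def)

text \<open>
  Serf groups and universal grading groups are both defined through a single-valued multimagma. This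
  identity, for which the product off the carrier has to be the default value, recognizes them.
\<close>

lemma group_of_mm_of_group:
  assumes "group G" "ext_mult G"
  shows "group_of_mm (mm_of_group G) = G"
proof (rule monoid.equality)
  show "monoid.mult (group_of_mm (mm_of_group G)) = monoid.mult G"
    using assms(2) by (intro ext) (auto simp: mult_group_of_mm_of_group[OF assms(1)] ext_mult_def)
qed (simp_all add: assms carrier_group_of_mm_of_group one_group_of_mm_of_group)

text \<open>
  Any group structure on the serfs may be replaced by one with the default product off the carrier,
  which is the serf group.
\<close>

lemma group_group_of_mm_of_group:
  assumes "group G"
  shows "group (group_of_mm (mm_of_group G))" "ext_mult (group_of_mm (mm_of_group G))"
proof -
  interpret group G by fact
  show "group (group_of_mm (mm_of_group G))"
    using l_inv_ex
    by (intro groupI)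
      (simp_all add: assms carrier_group_of_mm_of_group one_group_of_mm_of_group
         mult_group_of_mm_of_group m_assoc)
  show "ext_mult (group_of_mm (mm_of_group G))"
    by (simp add: ext_mult_def assms carrier_group_of_mm_of_group mult_group_of_mm_of_group)
qed

section \<open>Subgroups of index two\<close>

lemma (in group) rcoset_of_outsider:
  assumes N: "subgroup N G" and odd: "\<And>x y. \<lbrakk>x \<in> carrier G - N; y \<in> carrier G - N\<rbrakk> \<Longrightarrow> x \<otimes> y \<in> N"
    and x: "x \<in> carrier G - N"
  shows "N #> x = carrier G - N"
proof (intro equalityI subsetI)
  have inv_x: "inv x \<in> carrier G - N"
    using x N by (metis Diff_iff inv_closed inv_inv subgroup.m_inv_closed)
  fix y
  { assume "y \<in> carrier G - N"
    then have "y \<otimes> inv x \<in> N" using inv_x odd by blast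
    moreover have "y = (y \<otimes> inv x) \<otimes> x"
      using \<open>y \<in> carrier G - N\<close> x by (simp add: m_assoc)
    ultimately show "y \<in> N #> x" by (auto simp: r_coset_def) }
  assume "y \<in> N #> x"
  then obtain n where n: "n \<in> N" "y = n \<otimes> x" by (auto simp: r_coset_def)
  then have "n \<in> carrier G" using subgroup.mem_carrier[OF N] by simp
  moreover have "x \<in> N" if "y \<in> N"
  proof -
    have "inv n \<otimes> y = x" using n x \<open>n \<in> carrier G\<close> by (simp add: m_assoc[symmetric])
    then show ?thesis using n that N by (metis subgroup.m_closed subgroup.m_inv_closed)
  qed
  ultimately show "y \<in> carrier G - N" using n x by auto
qed

text \<open>
  Index two enters everywhere through the right-hand side, the rule that a product of two outsiders
  is an insider: it makes the sign that separates serfs from lords a grading.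
\<close>

lemma (in group) card_rcosets_eq_2_iff:
  assumes N: "subgroup N G"
  shows "card (rcosets N) = 2 \<longleftrightarrow>
    N \<noteq> carrier G \<and> (\<forall>x\<in>carrier G - N. \<forall>y\<in>carrier G - N. x \<otimes> y \<in> N)"
proof
  assume card: "card (rcosets N) = 2"
  have NR: "N \<in> rcosets N" using N by (simp add: is_group subgroup.subgroup_in_rcosets)
  then obtain R where R: "rcosets N = {N, R}"
    using card by (metis card_2_iff insert_commute insertE singletonD)
  have out: "N #> x = R" if "x \<in> carrier G - N" for x
  proof -
    have "x \<in> N #> x" using that N by (simp add: rcos_self)
    moreover have "N #> x \<in> rcosets N"
      using that N by (simp add: rcosetsI subgroup.subset)
    ultimately show ?thesis using R that by auto
  qed
  have "N \<noteq> carrier G"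
  proof
    assume "N = carrier G"
    then have "rcosets N \<subseteq> {N}"
      using coset_join2[OF _ N] by (auto simp: RCOSETS_def)
    then have "card (rcosets N) \<le> card {N}" by (intro card_mono) auto
    then show False using card by simp
  qed
  moreover have "x \<otimes> y \<in> N" if "x \<in> carrier G - N" "y \<in> carrier G - N" for x y
  proof -
    have "inv y \<in> carrier G - N"
      using that N by (metis Diff_iff inv_closed inv_inv subgroup.m_inv_closed)
    then have "N #> x = N #> inv y" using out that by simp
    then have "x \<in> N #> inv y" using that N rcos_self by blast
    then obtain n where "n \<in> N" "x = n \<otimes> inv y" by (auto simp: r_coset_def)
    then have "x \<otimes> y = n" using that N subgroup.mem_carrier[OF N] by (simp add: m_assoc)
    then show ?thesis using \<open>n \<in> N\<close> by simp
  qed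
  ultimately show "N \<noteq> carrier G \<and> (\<forall>x\<in>carrier G - N. \<forall>y\<in>carrier G - N. x \<otimes> y \<in> N)" by blast
next
  assume *: "N \<noteq> carrier G \<and> (\<forall>x\<in>carrier G - N. \<forall>y\<in>carrier G - N. x \<otimes> y \<in> N)"
  have sub: "N \<subseteq> carrier G" using N subgroup.subset by blast
  obtain x where x: "x \<in> carrier G - N" using * sub by blast
  have "N #> y = carrier G - N" if "y \<in> carrier G - N" for y
    using rcoset_of_outsider[OF N _ that] * by blast
  moreover have "N #> y = N" if "y \<in> N" for y
    using coset_join2[OF _ N that] that sub by blast
  ultimately have "rcosets N = {N, carrier G - N}"
    unfolding RCOSETS_def using x sub subgroup.one_closed[OF N] by (auto 4 4)
  moreover have "N \<noteq> carrier G - N" using subgroup.one_closed[OF N] by blast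
  ultimately show "card (rcosets N) = 2" by simp
qed

section \<open>The feudal fusion rule of a homomorphism\<close>

text \<open>
  The universal grading of \<open>\<Phi> H\<close>, as a map into the target of \<open>H\<close>.
\<close>

definition proj :: "'a hobj \<Rightarrow> 'a \<Rightarrow> 'a set" where
  "proj H x = (if x \<in> carrier (src H) then hmap H x else {x})"

lemma proj_serf: "x \<in> carrier (src H) \<Longrightarrow> proj H x = hmap H x"
  and proj_lord: "x \<notin> carrier (src H) \<Longrightarrow> proj H x = {x}"
  by (simp_all add: proj_def)

locale index_two_hom =
  fixes H :: "'a hobj"
  assumes hobject: "hobject H"
begin

abbreviation S where "S \<equiv> src H"
abbreviation G where "G \<equiv> tgt H"
abbreviation u where "u \<equiv> hmap H"
abbreviation K where "K \<equiv> kernel S G u"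
abbreviation L where "L \<equiv> Phi_ob H"

sublocale S: group S
  using hobject by (simp add: hobject_def)

sublocale G: group G
  using hobject by (simp add: hobject_def)

sublocale u: group_hom S G u
  using hobject by unfold_locales (simp add: hobject_def)

lemma ext_S: "ext_mult S" and ext_G: "ext_mult G" and ext_u: "u \<in> extensional (carrier S)"
  and finite_K: "finite K"
  using hobject by (simp_all add: hobject_def)

lemma u_coset: "a \<in> carrier S \<Longrightarrow> u a = K #>\<^bsub>S\<^esub> a"
  using hobject by (simp add: hobject_def)

lemma K_subgroup: "subgroup K S"
  by (rule u.subgroup_kernel)

lemma K_subset: "K \<subseteq> carrier S"
  using K_subgroup subgroup.subset by blast

lemma one_G: "\<one>\<^bsub>G\<^esub> = K"
  using u_coset[OF S.one_closed] S.coset_mult_one[OF K_subset] by simp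

lemma him_subgroup: "subgroup (him H) G"
  using u.img_is_subgroup by (simp add: him_def)

lemma him_subset: "him H \<subseteq> carrier G"
  using him_subgroup subgroup.subset by blast

lemma index_two: "card (rcosets\<^bsub>G\<^esub> (him H)) = 2"
  using hobject by (simp add: hobject_def)

lemma outsider_mult_outsider:
  "\<lbrakk>X \<in> carrier G; X \<notin> him H; Y \<in> carrier G; Y \<notin> him H\<rbrakk> \<Longrightarrow> X \<otimes>\<^bsub>G\<^esub> Y \<in> him H"
  using index_two G.card_rcosets_eq_2_iff[OF him_subgroup] by simp

lemma insider_mult_outsider:
  assumes "X \<in> him H" "Y \<in> carrier G" "Y \<notin> him H"
  shows "X \<otimes>\<^bsub>G\<^esub> Y \<notin> him H" and "Y \<otimes>\<^bsub>G\<^esub> X \<notin> him H"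
proof -
  have X: "X \<in> carrier G" and inv_X: "inv\<^bsub>G\<^esub> X \<in> him H"
    using assms him_subset subgroup.m_inv_closed[OF him_subgroup] by auto
  have "inv\<^bsub>G\<^esub> X \<otimes>\<^bsub>G\<^esub> (X \<otimes>\<^bsub>G\<^esub> Y) = Y" "(Y \<otimes>\<^bsub>G\<^esub> X) \<otimes>\<^bsub>G\<^esub> inv\<^bsub>G\<^esub> X = Y"
    using X assms by (simp_all add: G.m_assoc[symmetric]) (simp add: G.m_assoc)
  then show "X \<otimes>\<^bsub>G\<^esub> Y \<notin> him H" "Y \<otimes>\<^bsub>G\<^esub> X \<notin> him H"
    using inv_X assms(3) subgroup.m_closed[OF him_subgroup] by metis+
qed

lemma him_mult_iff:
  assumes "X \<in> carrier G" "Y \<in> carrier G"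
  shows "X \<otimes>\<^bsub>G\<^esub> Y \<in> him H \<longleftrightarrow> (X \<in> him H \<longleftrightarrow> Y \<in> him H)"
  using assms outsider_mult_outsider insider_mult_outsider subgroup.m_closed[OF him_subgroup]
  by (cases "X \<in> him H"; cases "Y \<in> him H") simp_all

lemma outsider_singleton:
  assumes "X \<in> carrier G" "X \<notin> him H"
  obtains m where "X = {m}" "m \<in> hlords H" "m \<notin> carrier S"
proof -
  have "\<forall>X \<in> carrier G - him H. \<exists>m. m \<notin> carrier S \<and> X = {m}"
    using hobject unfolding hobject_def by simp
  then obtain m where "m \<notin> carrier S" "X = {m}" using assms by auto
  then show thesis using assms that by (simp add: hlords_def)
qed

lemma hlordsD:
  assumes "m \<in> hlords H"
  shows "{m} \<in> carrier G" "{m} \<notin> him H" "m \<notin> carrier S"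
proof -
  show *: "{m} \<in> carrier G" "{m} \<notin> him H" using assms by (simp_all add: hlords_def)
  show "m \<notin> carrier S" using outsider_singleton[OF *] by (metis singleton_inject)
qed

lemma lord_exists: "\<exists>m. m \<in> hlords H"
proof -
  have "him H \<noteq> carrier G"
    using index_two G.card_rcosets_eq_2_iff[OF him_subgroup] by simp
  then obtain X where "X \<in> carrier G" "X \<notin> him H" using him_subset by auto
  then show ?thesis using outsider_singleton by metis
qed

lemma carrier_L: "carrier L = carrier S \<union> hlords H"
  by (simp add: Phi_ob_def)

lemma serf_in_L: "a \<in> carrier S \<Longrightarrow> a \<in> carrier L"
  by (simp add: carrier_L)

lemma hlord_iff: "x \<in> carrier L \<Longrightarrow> x \<in> hlords H \<longleftrightarrow> x \<notin> carrier S"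
  using hlordsD(3) by (auto simp: carrier_L)

lemma proj_closed: "x \<in> carrier L \<Longrightarrow> proj H x \<in> carrier G"
  using hlordsD by (auto simp: carrier_L proj_def)

lemma proj_in_him_iff: "x \<in> carrier L \<Longrightarrow> proj H x \<in> him H \<longleftrightarrow> x \<in> carrier S"
  using hlordsD by (auto simp: carrier_L proj_def him_def)

lemma proj_surj:
  assumes "X \<in> carrier G"
  obtains x where "x \<in> carrier L" "proj H x = X"
proof (cases "X \<in> him H")
  case True
  then obtain a where "a \<in> carrier S" "X = u a" by (auto simp: him_def)
  then show thesis using that[of a] by (simp add: proj_serf serf_in_L)
next
  case False
  then obtain m where "X = {m}" "m \<in> hlords H" "m \<notin> carrier S"
    using outsider_singleton assms by metis
  then show thesis using that[of m] by (simp add: proj_lord carrier_L)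
qed

lemma u_eq_iff: "\<lbrakk>a \<in> carrier S; b \<in> carrier S\<rbrakk> \<Longrightarrow> u b = u a \<longleftrightarrow> b \<in> u a"
  using S.repr_independence[OF _ _ K_subgroup] S.rcos_self[OF _ K_subgroup] u_coset by metis

text \<open>
  On serfs this is the convention that \<open>u a\<close> is a coset of the kernel, on lords the convention that
  the outsiders are singletons of non-serfs. It makes every element of \<open>G\<close> equal to its own fibre.
\<close>

lemma mem_proj_iff:
  assumes x: "x \<in> carrier L"
  shows "y \<in> proj H x \<longleftrightarrow> y \<in> carrier L \<and> proj H y = proj H x"
proof (cases "x \<in> carrier S")
  case True
  have sub: "u x \<subseteq> carrier S"
    using True S.r_coset_subset_G[OF K_subset] u_coset by simp
  show ?thesis
  proof
    assume "y \<in> proj H x"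
    then have "y \<in> u x" "y \<in> carrier S" using True sub by (auto simp: proj_serf)
    then show "y \<in> carrier L \<and> proj H y = proj H x"
      using True u_eq_iff by (simp add: proj_serf serf_in_L)
  next
    assume y: "y \<in> carrier L \<and> proj H y = proj H x"
    then have "y \<in> carrier S" using True proj_in_him_iff x by metis
    then show "y \<in> proj H x" using y True u_eq_iff by (simp add: proj_serf)
  qed
next
  case False
  show ?thesis
  proof
    assume "y \<in> proj H x"
    then show "y \<in> carrier L \<and> proj H y = proj H x" using False x by (simp add: proj_lord)
  next
    assume y: "y \<in> carrier L \<and> proj H y = proj H x"
    then have "y \<notin> carrier S" using False proj_in_him_iff x by metis
    then show "y \<in> proj H x" using y by (metis proj_lord singletonI)
  qed
qed

lemma mem_carrier_G_iff:
  "X \<in> carrier G \<Longrightarrow> z \<in> X \<longleftrightarrow> z \<in> carrier L \<and> proj H z = X"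
  using proj_surj mem_proj_iff by metis

lemma fiber_of_insider:
  assumes "X \<in> him H"
  shows "{a \<in> carrier S. u a = X} = X"
proof -
  have X: "X \<in> carrier G" using assms him_subset by blast
  have "a \<in> carrier S \<and> u a = X \<longleftrightarrow> a \<in> carrier L \<and> proj H a = X" for a
    using assms proj_in_him_iff proj_serf serf_in_L by metis
  then show ?thesis by (simp add: mem_carrier_G_iff[OF X, symmetric])
qed

lemma proj_lord_eq: "\<lbrakk>x \<in> carrier L; y \<in> carrier L; x \<notin> carrier S\<rbrakk> \<Longrightarrow> proj H y = proj H x \<longleftrightarrow> y = x"
  using mem_proj_iff[of x y] by (simp add: proj_lord)

lemma finite_card_carrier_G:
  assumes "X \<in> carrier G"
  shows "finite X" and "card X = (if X \<in> him H then card K else 1)"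
proof -
  have "finite X \<and> card X = (if X \<in> him H then card K else 1)"
  proof (cases "X \<in> him H")
    case True
    then obtain a where a: "a \<in> carrier S" "X = K #>\<^bsub>S\<^esub> a" by (auto simp: him_def u_coset)
    then have "X \<in> rcosets\<^bsub>S\<^esub> K" using S.rcosetsI K_subset by simp
    then obtain f where "bij_betw f K X" using S.card_cosets_equal K_subset by metis
    then show ?thesis using True finite_K bij_betw_same_card bij_betw_finite by metis
  next
    case False
    then obtain m where "X = {m}" using outsider_singleton assms by metis
    then show ?thesis using False by simp
  qed
  then show "finite X" "card X = (if X \<in> him H then card K else 1)" by simp_all
qed

text \<open>
  The support of the product in \<open>\<Phi> H\<close>. An element of \<open>G\<close> is its own fibre, so the three clauses of
  the fusion that involve a lord become one.
\<close>

definition prod_set :: "'a \<Rightarrow> 'a \<Rightarrow> 'a set" where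
  "prod_set x y = (if x \<in> carrier S \<and> y \<in> carrier S then {x \<otimes>\<^bsub>S\<^esub> y} else proj H x \<otimes>\<^bsub>G\<^esub> proj H y)"

lemma prod_set_serfs: "\<lbrakk>x \<in> carrier S; y \<in> carrier S\<rbrakk> \<Longrightarrow> prod_set x y = {x \<otimes>\<^bsub>S\<^esub> y}"
  by (simp add: prod_set_def)

lemma mem_prod_set_iff:
  assumes "x \<in> carrier L" "y \<in> carrier L" "x \<notin> carrier S \<or> y \<notin> carrier S"
  shows "z \<in> prod_set x y \<longleftrightarrow> z \<in> carrier L \<and> proj H z = proj H x \<otimes>\<^bsub>G\<^esub> proj H y"
  using assms by (auto simp: prod_set_def mem_carrier_G_iff proj_closed)

lemma prod_setD:
  assumes "x \<in> carrier L" "y \<in> carrier L" "z \<in> prod_set x y"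
  shows "z \<in> carrier L" and "proj H z = proj H x \<otimes>\<^bsub>G\<^esub> proj H y"
    and "z \<in> carrier S \<longleftrightarrow> (x \<in> carrier S \<longleftrightarrow> y \<in> carrier S)"
proof -
  show *: "z \<in> carrier L" "proj H z = proj H x \<otimes>\<^bsub>G\<^esub> proj H y"
  proof (atomize (full), cases "x \<in> carrier S \<and> y \<in> carrier S")
    case True
    then show "z \<in> carrier L \<and> proj H z = proj H x \<otimes>\<^bsub>G\<^esub> proj H y"
      using assms(3) by (simp add: prod_set_serfs proj_serf serf_in_L)
  next
    case False
    then show "z \<in> carrier L \<and> proj H z = proj H x \<otimes>\<^bsub>G\<^esub> proj H y"
      using assms mem_prod_set_iff by simp
  qed
  show "z \<in> carrier S \<longleftrightarrow> (x \<in> carrier S \<longleftrightarrow> y \<in> carrier S)"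
    using him_mult_iff[of "proj H x" "proj H y"] proj_in_him_iff proj_closed assms * by metis
qed

lemma finite_prod_set: "\<lbrakk>x \<in> carrier L; y \<in> carrier L\<rbrakk> \<Longrightarrow> finite (prod_set x y)"
  by (simp add: prod_set_def finite_card_carrier_G proj_closed)

lemma card_prod_set:
  assumes "x \<in> carrier L" "y \<in> carrier L"
  shows "card (prod_set x y) = (if x \<notin> carrier S \<and> y \<notin> carrier S then card K else 1)"
  using assms
  by (auto simp: prod_set_def finite_card_carrier_G proj_closed him_mult_iff proj_in_him_iff)

lemma fusion_L:
  assumes "x \<in> carrier L" "y \<in> carrier L"
  shows "fusion L x y = ind (prod_set x y)"
proof -
  have X: "proj H x \<otimes>\<^bsub>G\<^esub> proj H y \<in> carrier G" using assms proj_closed by simp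
  show ?thesis
  proof (cases "x \<in> carrier S \<longleftrightarrow> y \<in> carrier S")
    case True
    then show ?thesis
    proof (cases "x \<in> carrier S")
      case False
      have "proj H x \<otimes>\<^bsub>G\<^esub> proj H y \<in> him H"
        using X True False him_mult_iff proj_in_him_iff proj_closed assms by metis
      from fiber_of_insider[OF this] show ?thesis
        using True False assms
        by (simp add: Phi_ob_def Phi_fusion_def Let_def prod_set_def proj_lord carrier_L)
    qed (simp add: Phi_ob_def Phi_fusion_def Let_def prod_set_def)
  next
    case False
    then have "proj H x \<otimes>\<^bsub>G\<^esub> proj H y \<notin> him H"
      using X him_mult_iff proj_in_him_iff proj_closed assms by metis
    then obtain m where "proj H x \<otimes>\<^bsub>G\<^esub> proj H y = {m}" using outsider_singleton[OF X] by metis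
    then have "{l. {l} = proj H x \<otimes>\<^bsub>G\<^esub> proj H y} = proj H x \<otimes>\<^bsub>G\<^esub> proj H y" by auto
    moreover have "x \<in> hlords H \<longleftrightarrow> x \<notin> carrier S" "y \<in> hlords H \<longleftrightarrow> y \<notin> carrier S"
      using assms hlord_iff by simp_all
    ultimately show ?thesis
      using False
      by (cases "x \<in> carrier S")
        (simp_all add: Phi_ob_def Phi_fusion_def Let_def prod_set_def proj_lord proj_serf)
  qed
qed

lemma fusion_L_outside: "x \<notin> carrier L \<or> y \<notin> carrier L \<Longrightarrow> fusion L x y = ind {}"
  by (auto simp: Phi_ob_def Phi_fusion_def Let_def)

text \<open>
  The number of ways to reach \<open>v\<close> from \<open>x\<close>, \<open>y\<close>, \<open>z\<close>, bracketed to the left. If the second step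
  involves a lord, every element of the product of \<open>x\<close> and \<open>y\<close> is a possible first result; otherwise
  the second step is the product of two serfs, and \<open>v\<close> determines the first result.
\<close>

lemma card_left_products:
  assumes L: "x \<in> carrier L" "y \<in> carrier L" "z \<in> carrier L" "v \<in> carrier L"
    and v: "proj H v = proj H x \<otimes>\<^bsub>G\<^esub> proj H y \<otimes>\<^bsub>G\<^esub> proj H z"
    and serfs: "\<lbrakk>x \<in> carrier S; y \<in> carrier S; z \<in> carrier S\<rbrakk> \<Longrightarrow> v = x \<otimes>\<^bsub>S\<^esub> y \<otimes>\<^bsub>S\<^esub> z"
  shows "card {w \<in> prod_set x y. v \<in> prod_set w z} =
    (if x \<notin> carrier S \<and> y \<notin> carrier S \<and> z \<notin> carrier S then card K else 1)"
proof -
  consider (all) "z \<notin> carrier S \<or> (x \<in> carrier S \<longleftrightarrow> y \<notin> carrier S)"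
    | (serfs) "x \<in> carrier S" "y \<in> carrier S" "z \<in> carrier S"
    | (lords) "x \<notin> carrier S" "y \<notin> carrier S" "z \<in> carrier S" by blast
  then show ?thesis
  proof cases
    case all
    have "v \<in> prod_set w z" if "w \<in> prod_set x y" for w
      using prod_setD[OF L(1,2) that] all mem_prod_set_iff[of w z v] L v by auto
    then have "{w \<in> prod_set x y. v \<in> prod_set w z} = prod_set x y" by auto
    then show ?thesis using card_prod_set L all by auto
  next
    case serfs
    then have "{w \<in> prod_set x y. v \<in> prod_set w z} = {x \<otimes>\<^bsub>S\<^esub> y}"
      using assms(6) by (auto simp: prod_set_serfs)
    then show ?thesis using serfs by simp
  next
    case lords
    have vS: "v \<in> carrier S"
      using v L lords proj_in_him_iff him_mult_iff proj_closed G.m_closed by metis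
    have "{w \<in> prod_set x y. v \<in> prod_set w z} = {v \<otimes>\<^bsub>S\<^esub> inv\<^bsub>S\<^esub> z}"
    proof (intro equalityI subsetI)
      fix w assume "w \<in> {w \<in> prod_set x y. v \<in> prod_set w z}"
      then have "w \<in> carrier S" "v = w \<otimes>\<^bsub>S\<^esub> z"
        using prod_setD[OF L(1,2)] lords by (auto simp: prod_set_serfs)
      then show "w \<in> {v \<otimes>\<^bsub>S\<^esub> inv\<^bsub>S\<^esub> z}" using lords by (simp add: S.m_assoc)
    next
      fix w assume w: "w \<in> {v \<otimes>\<^bsub>S\<^esub> inv\<^bsub>S\<^esub> z}"
      then have wS: "w \<in> carrier S" "w \<otimes>\<^bsub>S\<^esub> z = v" using lords vS by (simp_all add: S.m_assoc)
      then have "proj H w \<otimes>\<^bsub>G\<^esub> proj H z = proj H x \<otimes>\<^bsub>G\<^esub> proj H y \<otimes>\<^bsub>G\<^esub> proj H z"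
        using v lords vS by (metis proj_serf u.hom_mult)
      then have "proj H w = proj H x \<otimes>\<^bsub>G\<^esub> proj H y"
        using L wS proj_closed serf_in_L by simp
      then have "w \<in> prod_set x y" using mem_prod_set_iff L lords wS serf_in_L by simp
      then show "w \<in> {w \<in> prod_set x y. v \<in> prod_set w z}"
        using wS lords by (simp add: prod_set_serfs)
    qed
    then show ?thesis using lords by simp
  qed
qed

text \<open>
  The same number for the other bracketing. The right-hand side is the same as in
  \<open>card_left_products\<close>, which is the associativity of the fusion.
\<close>

lemma card_right_products:
  assumes L: "x \<in> carrier L" "y \<in> carrier L" "z \<in> carrier L" "v \<in> carrier L"
    and v: "proj H v = proj H x \<otimes>\<^bsub>G\<^esub> proj H y \<otimes>\<^bsub>G\<^esub> proj H z"
    and serfs: "\<lbrakk>x \<in> carrier S; y \<in> carrier S; z \<in> carrier S\<rbrakk> \<Longrightarrow> v = x \<otimes>\<^bsub>S\<^esub> y \<otimes>\<^bsub>S\<^esub> z"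
  shows "card {w \<in> prod_set y z. v \<in> prod_set x w} =
    (if x \<notin> carrier S \<and> y \<notin> carrier S \<and> z \<notin> carrier S then card K else 1)"
proof -
  have v': "proj H v = proj H x \<otimes>\<^bsub>G\<^esub> (proj H y \<otimes>\<^bsub>G\<^esub> proj H z)"
    using v L proj_closed by (simp add: G.m_assoc)
  consider (all) "x \<notin> carrier S \<or> (y \<in> carrier S \<longleftrightarrow> z \<notin> carrier S)"
    | (serfs) "x \<in> carrier S" "y \<in> carrier S" "z \<in> carrier S"
    | (lords) "x \<in> carrier S" "y \<notin> carrier S" "z \<notin> carrier S" by blast
  then show ?thesis
  proof cases
    case all
    have "v \<in> prod_set x w" if "w \<in> prod_set y z" for w
      using prod_setD[OF L(2,3) that] all mem_prod_set_iff[of x w v] L v' by auto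
    then have "{w \<in> prod_set y z. v \<in> prod_set x w} = prod_set y z" by auto
    then show ?thesis using card_prod_set L all by auto
  next
    case serfs
    then have "{w \<in> prod_set y z. v \<in> prod_set x w} = {y \<otimes>\<^bsub>S\<^esub> z}"
      using assms(6) by (auto simp: prod_set_serfs S.m_assoc)
    then show ?thesis using serfs by simp
  next
    case lords
    have vS: "v \<in> carrier S"
      using v' L lords proj_in_him_iff him_mult_iff proj_closed G.m_closed by metis
    have "{w \<in> prod_set y z. v \<in> prod_set x w} = {inv\<^bsub>S\<^esub> x \<otimes>\<^bsub>S\<^esub> v}"
    proof (intro equalityI subsetI)
      fix w assume "w \<in> {w \<in> prod_set y z. v \<in> prod_set x w}"
      then have "w \<in> carrier S" "v = x \<otimes>\<^bsub>S\<^esub> w"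
        using prod_setD[OF L(2,3)] lords by (auto simp: prod_set_serfs)
      then show "w \<in> {inv\<^bsub>S\<^esub> x \<otimes>\<^bsub>S\<^esub> v}" using lords by (simp add: S.m_assoc[symmetric])
    next
      fix w assume w: "w \<in> {inv\<^bsub>S\<^esub> x \<otimes>\<^bsub>S\<^esub> v}"
      then have wS: "w \<in> carrier S" "x \<otimes>\<^bsub>S\<^esub> w = v"
        using lords vS by (simp_all add: S.m_assoc[symmetric])
      then have "proj H x \<otimes>\<^bsub>G\<^esub> proj H w = proj H x \<otimes>\<^bsub>G\<^esub> (proj H y \<otimes>\<^bsub>G\<^esub> proj H z)"
        using v' lords vS by (metis proj_serf u.hom_mult)
      then have "proj H w = proj H y \<otimes>\<^bsub>G\<^esub> proj H z"
        using L wS proj_closed serf_in_L by simp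
      then have "w \<in> prod_set y z" using mem_prod_set_iff L lords wS serf_in_L by simp
      then show "w \<in> {w \<in> prod_set y z. v \<in> prod_set x w}"
        using wS lords by (simp add: prod_set_serfs)
    qed
    then show ?thesis using lords by simp
  qed
qed

lemma card_products_assoc:
  assumes L: "x \<in> carrier L" "y \<in> carrier L" "z \<in> carrier L"
  shows "card {w \<in> prod_set x y. v \<in> prod_set w z} = card {w \<in> prod_set y z. v \<in> prod_set x w}"
proof -
  let ?ok = "v \<in> carrier L \<and> proj H v = proj H x \<otimes>\<^bsub>G\<^esub> proj H y \<otimes>\<^bsub>G\<^esub> proj H z \<and>
    (x \<in> carrier S \<longrightarrow> y \<in> carrier S \<longrightarrow> z \<in> carrier S \<longrightarrow> v = x \<otimes>\<^bsub>S\<^esub> y \<otimes>\<^bsub>S\<^esub> z)"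
  have left: ?ok if "w \<in> prod_set x y" "v \<in> prod_set w z" for w
    using prod_setD[OF L(1,2) that(1)] prod_setD[OF _ L(3) that(2)] that
    by (auto simp: prod_set_serfs)
  have right: ?ok if "w \<in> prod_set y z" "v \<in> prod_set x w" for w
    using prod_setD[OF L(2,3) that(1)] prod_setD[OF L(1) _ that(2)] that L
    by (auto simp: prod_set_serfs S.m_assoc G.m_assoc proj_closed)
  show ?thesis
  proof (cases ?ok)
    case True
    then show ?thesis using card_left_products[OF L] card_right_products[OF L] by simp
  next
    case False
    then have "{w \<in> prod_set x y. v \<in> prod_set w z} = {}" "{w \<in> prod_set y z. v \<in> prod_set x w} = {}"
      using left right by blast+
    then show ?thesis by (simp only: card.empty)
  qed
qed

lemma prod_set_nonempty:
  assumes x: "x \<in> carrier L" and y: "y \<in> carrier L"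
  shows "prod_set x y \<noteq> {}"
proof (cases "x \<in> carrier S \<and> y \<in> carrier S")
  case True
  then show ?thesis by (simp add: prod_set_serfs)
next
  case False
  obtain z where "z \<in> carrier L" "proj H z = proj H x \<otimes>\<^bsub>G\<^esub> proj H y"
    using proj_surj[of "proj H x \<otimes>\<^bsub>G\<^esub> proj H y"] x y proj_closed by blast
  then have "z \<in> prod_set x y" using mem_prod_set_iff[OF x y] False by simp
  then show ?thesis by blast
qed

lemma fusion_rule_assoc:
  assumes L: "x \<in> carrier L" "y \<in> carrier L" "z \<in> carrier L"
  shows "mprod L (fusion L x y) (ind {z}) = mprod L (ind {x}) (fusion L y z)"
proof (rule ext)
  fix v
  have "mprod L (fusion L x y) (ind {z}) v = (\<Sum>w\<in>prod_set x y. ind (prod_set x y) w * ind (prod_set w z) v)"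
    unfolding mprod_ind_right
    using L by (intro sum.cong) (simp_all add: fusion_L prod_setD(1)[OF L(1,2)])
  also have "\<dots> = card {w \<in> prod_set x y. v \<in> prod_set w z}"
    using L by (intro sum_ind_eq_card finite_prod_set)
  also have "\<dots> = card {w \<in> prod_set y z. v \<in> prod_set x w}"
    by (rule card_products_assoc[OF L])
  also have "\<dots> = (\<Sum>w\<in>prod_set y z. ind (prod_set y z) w * ind (prod_set x w) v)"
    using L by (intro sum_ind_eq_card[symmetric] finite_prod_set)
  also have "\<dots> = mprod L (ind {x}) (fusion L y z) v"
    unfolding mprod_ind_left
    using L by (intro sum.cong) (simp_all add: fusion_L prod_setD(1)[OF L(2,3)])
  finally show "mprod L (fusion L x y) (ind {z}) v = mprod L (ind {x}) (fusion L y z) v" .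
qed

lemma proj_one: "proj H \<one>\<^bsub>S\<^esub> = \<one>\<^bsub>G\<^esub>"
  by (simp add: proj_serf)

lemma prod_set_one:
  assumes "x \<in> carrier L"
  shows "prod_set \<one>\<^bsub>S\<^esub> x = {x}" and "prod_set x \<one>\<^bsub>S\<^esub> = {x}"
  using assms proj_closed[OF assms]
  by (cases "x \<in> carrier S"; simp add: prod_set_def proj_one proj_lord)+

lemma is_unit_of_one: "is_unit_of L \<one>\<^bsub>S\<^esub>"
  by (simp add: is_unit_of_def serf_in_L fusion_L prod_set_one)

lemma unit_of_L: "unit_of L = \<one>\<^bsub>S\<^esub>"
  by (rule unit_of_eq[OF is_unit_of_one])

lemma is_conj_of_serf:
  assumes "a \<in> carrier S"
  shows "is_conj_of L \<one>\<^bsub>S\<^esub> a (inv\<^bsub>S\<^esub> a)"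
proof -
  have "(\<one>\<^bsub>S\<^esub> \<in> prod_set a y \<longleftrightarrow> y = inv\<^bsub>S\<^esub> a) \<and> (\<one>\<^bsub>S\<^esub> \<in> prod_set y a \<longleftrightarrow> y = inv\<^bsub>S\<^esub> a)"
    if y: "y \<in> carrier L" for y
  proof (cases "y \<in> carrier S")
    case True
    have "\<one>\<^bsub>S\<^esub> = a \<otimes>\<^bsub>S\<^esub> y \<longleftrightarrow> y = inv\<^bsub>S\<^esub> a" "\<one>\<^bsub>S\<^esub> = y \<otimes>\<^bsub>S\<^esub> a \<longleftrightarrow> y = inv\<^bsub>S\<^esub> a"
      using True assms S.inv_equality S.l_inv S.r_inv S.inv_inv S.inv_closed by metis+
    then show ?thesis using True assms by (simp add: prod_set_serfs)
  next
    case False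
    have "\<one>\<^bsub>S\<^esub> \<notin> prod_set a y" "\<one>\<^bsub>S\<^esub> \<notin> prod_set y a"
      using prod_setD(3)[of a y "\<one>\<^bsub>S\<^esub>"] prod_setD(3)[of y a "\<one>\<^bsub>S\<^esub>"] y False assms serf_in_L
      by auto
    then show ?thesis using False assms by auto
  qed
  then show ?thesis
    using assms by (auto simp: is_conj_of_def serf_in_L fusion_L ind_def)
qed

text \<open>
  The conjugate of a lord is its inverse in \<open>G\<close>, which lies outside the image of \<open>u\<close> again.
\<close>

lemma is_conj_of_lord:
  assumes "m \<in> carrier L" "m \<notin> carrier S" "n \<in> carrier L" "proj H n = inv\<^bsub>G\<^esub> (proj H m)"
  shows "is_conj_of L \<one>\<^bsub>S\<^esub> m n"
proof -
  have n: "n \<notin> carrier S"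
  proof
    assume "n \<in> carrier S"
    then have "inv\<^bsub>G\<^esub> (inv\<^bsub>G\<^esub> (proj H m)) \<in> him H"
      using assms proj_in_him_iff subgroup.m_inv_closed[OF him_subgroup] by metis
    then show False using assms proj_in_him_iff proj_closed by simp
  qed
  have "(\<one>\<^bsub>S\<^esub> \<in> prod_set m y \<longleftrightarrow> y = n) \<and> (\<one>\<^bsub>S\<^esub> \<in> prod_set y m \<longleftrightarrow> y = n)"
    if y: "y \<in> carrier L" for y
  proof -
    have m': "proj H m \<in> carrier G" and y': "proj H y \<in> carrier G"
      using assms y proj_closed by auto
    have "\<one>\<^bsub>G\<^esub> = proj H m \<otimes>\<^bsub>G\<^esub> proj H y \<longleftrightarrow> proj H y = proj H n"
      "\<one>\<^bsub>G\<^esub> = proj H y \<otimes>\<^bsub>G\<^esub> proj H m \<longleftrightarrow> proj H y = proj H n"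
      using m' y' assms(4) G.inv_equality G.l_inv G.r_inv G.inv_inv G.inv_closed by metis+
    moreover have "proj H y = proj H n \<longleftrightarrow> y = n"
      using proj_lord_eq[OF assms(3) y n] .
    ultimately show ?thesis
      using mem_prod_set_iff y assms(1,2) serf_in_L[OF S.one_closed] by (simp add: proj_one)
  qed
  then show ?thesis
    using assms by (auto simp: is_conj_of_def fusion_L ind_def)
qed

lemma is_conj_of_exists:
  assumes "x \<in> carrier L"
  obtains x' where "is_conj_of L \<one>\<^bsub>S\<^esub> x x'" "x' \<in> carrier L" "proj H x' = inv\<^bsub>G\<^esub> (proj H x)"
proof (cases "x \<in> carrier S")
  case True
  then show thesis using that[OF is_conj_of_serf] by (simp add: serf_in_L proj_serf)
next
  case False
  obtain n where n: "n \<in> carrier L" "proj H n = inv\<^bsub>G\<^esub> (proj H x)"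
    using proj_surj assms proj_closed by (metis G.inv_closed)
  then show thesis using that[OF is_conj_of_lord] assms False by simp
qed

lemma conj_of_L:
  assumes "x \<in> carrier L"
  shows "conj_of L x \<in> carrier L" and "proj H (conj_of L x) = inv\<^bsub>G\<^esub> (proj H x)"
proof -
  obtain x' where x': "is_conj_of L \<one>\<^bsub>S\<^esub> x x'" "x' \<in> carrier L" "proj H x' = inv\<^bsub>G\<^esub> (proj H x)"
    using is_conj_of_exists assms by metis
  then have "conj_of L x = x'" by (simp add: conj_of_eq unit_of_L)
  then show "conj_of L x \<in> carrier L" "proj H (conj_of L x) = inv\<^bsub>G\<^esub> (proj H x)"
    using x' by simp_all
qed

lemma conj_of_serf: "a \<in> carrier S \<Longrightarrow> conj_of L a = inv\<^bsub>S\<^esub> a"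
  using is_conj_of_serf by (simp add: conj_of_eq unit_of_L)

lemma fusion_rule_L: "fusion_rule L"
  unfolding fusion_rule_def
proof (intro conjI)
  show "multimagma L"
    unfolding multimagma_def
  proof (intro allI impI)
    fix x y z assume pos: "fusion L x y z > 0"
    then have xy: "x \<in> carrier L" "y \<in> carrier L"
      using fusion_L_outside[of x y] by (metis empty_iff ind_def less_numeral_extra(3))+
    then have "z \<in> prod_set x y" using pos fusion_L by (auto simp: ind_def split: if_splits)
    then show "x \<in> carrier L \<and> y \<in> carrier L \<and> z \<in> carrier L"
      using xy prod_setD(1)[OF xy] by simp
  qed
  show "locally_finite L"
    by (simp add: locally_finite_def fusion_L finite_prod_set)
  show "\<forall>x\<in>carrier L. \<forall>y\<in>carrier L. \<forall>z\<in>carrier L.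
      mprod L (fusion L x y) (ind {z}) = mprod L (ind {x}) (fusion L y z)"
    by (simp add: fusion_rule_assoc)
  show "\<exists>e. is_unit_of L e \<and> (\<forall>x\<in>carrier L. \<exists>x'. is_conj_of L e x x')"
    using is_unit_of_one is_conj_of_exists by metis
qed

lemma grade_L: "x \<in> carrier L \<Longrightarrow> grade L x = (if x \<in> carrier S then 1 else -1)"
  by (simp add: Phi_ob_def)

lemma serfs_L: "serfs L = carrier S"
  by (auto simp: serfs_def grade_L serf_in_L split: if_splits)

lemma grading_L: "grading Z2 L (grade L)"
  unfolding grading_def
proof
  have "grade L z = grade L x * grade L y"
    if "x \<in> carrier L" "y \<in> carrier L" "z \<in> prod_set x y" for x y z
    using prod_setD[OF that] that by (auto simp: grade_L)
  then show "grade L \<in> mm_hom (floor_mm L) (mm_of_group Z2)"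
    by (auto simp: mm_hom_def floor_mm_def mm_of_group_def Z2_def grade_L fusion_L)
  have "1 \<in> grade L ` carrier L"
    using grade_L[of "\<one>\<^bsub>S\<^esub>"] serf_in_L[of "\<one>\<^bsub>S\<^esub>"] by force
  moreover have "-1 \<in> grade L ` carrier L"
  proof -
    obtain m where "m \<in> carrier L" "m \<notin> carrier S"
      using lord_exists hlordsD(3) carrier_L by blast
    then show ?thesis using grade_L[of m] by force
  qed
  ultimately show "grade L ` carrier L = carrier Z2"
    by (auto simp: Z2_def grade_L)
qed

lemma sub_mm_serfs_L: "sub_mm L (serfs L) = mm_of_group S"
proof -
  have "fusion (sub_mm L (serfs L)) x y z = fusion (mm_of_group S) x y z" for x y z
    by (auto simp: sub_mm_def mm_of_group_def serfs_L fusion_L serf_in_L prod_set_serfs ind_def)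
  then show ?thesis
    by (intro multimagma.equality ext) (simp_all add: sub_mm_def mm_of_group_def serfs_L)
qed

lemma feudal_rule_Phi_ob: "feudal_rule L"
  unfolding feudal_rule_def
  using fusion_rule_L grading_L sub_mm_serfs_L S.group_axioms
  by (auto simp: Phi_ob_def intro!: exI[of _ S])

section \<open>Recovering the homomorphism from its fusion rule\<close>

lemma mem_K_iff: "x \<in> carrier L \<Longrightarrow> x \<in> K \<longleftrightarrow> proj H x = \<one>\<^bsub>G\<^esub>"
  using mem_carrier_G_iff[OF G.one_closed] by (simp add: one_G)

lemma K_subrule: "subrule L K"
  unfolding subrule_def
proof (intro conjI ballI impI)
  show "K \<subseteq> carrier L" using K_subset serf_in_L by auto
  show "unit_of L \<in> K" using mem_K_iff serf_in_L by (simp add: unit_of_L proj_one)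
  fix z assume z: "z \<in> carrier L"
    "conj_of L z \<in> K \<or> (\<exists>x\<in>K. \<exists>y\<in>K. z \<in> floor_set (fusion L x y))"
  from z(2) have "proj H z = \<one>\<^bsub>G\<^esub>"
  proof
    assume "conj_of L z \<in> K"
    then have "inv\<^bsub>G\<^esub> (proj H z) = \<one>\<^bsub>G\<^esub>" using conj_of_L z(1) mem_K_iff by metis
    then show ?thesis using z(1) proj_closed by (metis G.inv_inv G.inv_one)
  next
    assume "\<exists>x\<in>K. \<exists>y\<in>K. z \<in> floor_set (fusion L x y)"
    then obtain x y where xy: "x \<in> K" "y \<in> K" "z \<in> floor_set (fusion L x y)" by blast
    then have "x \<in> carrier L" "y \<in> carrier L" using K_subset serf_in_L by auto
    then show ?thesis using xy mem_K_iff prod_setD(2)[of x y z] by (simp add: fusion_L)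
  qed
  then show "z \<in> K" using z(1) mem_K_iff by simp
qed

lemma prod_conj_of_lord:
  assumes "m \<in> carrier L" "m \<notin> carrier S"
  shows "prod_set m (conj_of L m) = K"
  using assms conj_of_L proj_closed by (simp add: prod_set_def one_G)

text \<open>
  A serf contributes only the unit, while a lord contributes all of \<open>K\<close> at once; so a single lord
  shows that no smaller subrule will do.
\<close>

lemma adjoint_subrule_L: "adjoint_subrule L = K"
  unfolding adjoint_subrule_def
proof (rule equalityI)
  have "floor_set (fusion L x (conj_of L x)) \<subseteq> K" if "x \<in> carrier L" for x
  proof (cases "x \<in> carrier S")
    case True
    then show ?thesis
      using subgroup.one_closed[OF K_subgroup]
      by (simp add: conj_of_serf fusion_L serf_in_L prod_set_serfs)
  next
    case False
    then show ?thesis using that conj_of_L by (simp add: fusion_L prod_conj_of_lord)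
  qed
  then show "\<Inter> {T. subrule L T \<and> (\<forall>x\<in>carrier L. floor_set (fusion L x (conj_of L x)) \<subseteq> T)} \<subseteq> K"
    using K_subrule by blast
  obtain m where m: "m \<in> carrier L" "m \<notin> carrier S"
    using lord_exists hlordsD(3) carrier_L by blast
  then have "floor_set (fusion L m (conj_of L m)) = K"
    using conj_of_L by (simp add: fusion_L prod_conj_of_lord)
  then show "K \<subseteq> \<Inter> {T. subrule L T \<and> (\<forall>x\<in>carrier L. floor_set (fusion L x (conj_of L x)) \<subseteq> T)}"
    using m(1) by blast
qed

text \<open>
  The coset of a serf is a left coset of \<open>K\<close>, whereas \<open>u\<close> is given by right cosets: they agree
  because kernels are normal.
\<close>

lemma left_coset_L:
  assumes "x \<in> carrier L"
  shows "left_coset L K x = proj H x"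
proof (cases "x \<in> carrier S")
  case True
  have "left_coset L K x = x <#\<^bsub>S\<^esub> K"
    using True K_subset serf_in_L
    by (auto simp: left_coset_def l_coset_def fusion_L prod_set_serfs subset_iff)
  also have "\<dots> = K #>\<^bsub>S\<^esub> x"
    using normal.coset_eq[OF u.normal_kernel] True by simp
  finally show ?thesis using True u_coset by (simp add: proj_serf)
next
  case False
  have "prod_set x k = proj H x" if "k \<in> K" for k
  proof -
    have "k \<in> carrier L" using that K_subset serf_in_L by blast
    then have "proj H k = \<one>\<^bsub>G\<^esub>" using that mem_K_iff by simp
    then show ?thesis using False assms proj_closed by (simp add: prod_set_def)
  qed
  moreover have "floor_set (fusion L x k) = prod_set x k" if "k \<in> K" for k
    using that assms K_subset serf_in_L by (simp add: fusion_L subset_iff)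
  ultimately show ?thesis
    using subgroup.one_closed[OF K_subgroup] by (auto simp: left_coset_def)
qed

lemma univ_grading_L: "x \<in> carrier L \<Longrightarrow> univ_grading L x = proj H x"
  by (simp add: univ_grading_def adjoint_subrule_L left_coset_L)

lemma cosets_L: "left_coset L K ` carrier L = carrier G"
proof -
  have "left_coset L K ` carrier L = proj H ` carrier L"
    by (rule image_cong) (simp_all add: left_coset_L)
  also have "\<dots> = carrier G"
  proof
    show "proj H ` carrier L \<subseteq> carrier G" using proj_closed by blast
    show "carrier G \<subseteq> proj H ` carrier L"
    proof
      fix X assume "X \<in> carrier G"
      then show "X \<in> proj H ` carrier L" by (rule proj_surj) blast
    qed
  qed
  finally show ?thesis .
qed

text \<open>
  Multiplicities in \<open>\<Phi> H\<close> are 0 or 1, so the maximum in the definition of \<open>L/T\<close> is positive exactly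
  if some product of representatives reaches \<open>Z\<close>.
\<close>

lemma coset_mm_fusion:
  assumes "X \<in> carrier G" "Y \<in> carrier G" "Z \<in> carrier G"
  shows "fusion (coset_mm L K) X Y Z > 0 \<longleftrightarrow> Z = X \<otimes>\<^bsub>G\<^esub> Y"
proof -
  let ?M = "{fusion L x y z |x y z. x \<in> X \<and> y \<in> Y \<and> z \<in> Z}"
  obtain x where x: "x \<in> carrier L" "proj H x = X" using proj_surj assms(1) by blast
  obtain y where y: "y \<in> carrier L" "proj H y = Y" using proj_surj assms(2) by blast
  obtain z where z: "z \<in> carrier L" "proj H z = Z" using proj_surj assms(3) by blast
  note xyz = x y z
  note mem = assms[THEN mem_carrier_G_iff]
  have fusion_ind: "fusion L a b = ind (prod_set a b)" if "a \<in> X" "b \<in> Y" for a b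
    using that mem by (simp add: fusion_L)
  have "?M \<subseteq> {0, 1}"
  proof
    fix n assume "n \<in> ?M"
    then obtain a b c where "n = fusion L a b c" "a \<in> X" "b \<in> Y" by blast
    then show "n \<in> {0, 1}" by (simp add: fusion_ind ind_def)
  qed
  then have fin: "finite ?M" by (rule finite_subset) simp
  have "x \<in> X" "y \<in> Y" "z \<in> Z" using xyz mem by simp_all
  then have "?M \<noteq> {}" by blast
  then have "Max ?M > 0 \<longleftrightarrow> (\<exists>n\<in>?M. n > 0)" using fin by (simp add: Max_gr_iff)
  also have "\<dots> \<longleftrightarrow> (\<exists>x y z. x \<in> X \<and> y \<in> Y \<and> z \<in> Z \<and> fusion L x y z > 0)"
    by blast
  also have "\<dots> \<longleftrightarrow> (\<exists>x y z. x \<in> X \<and> y \<in> Y \<and> z \<in> Z \<and> z \<in> prod_set x y)"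
    by (intro ex_cong1 conj_cong refl) (simp add: fusion_ind ind_def)
  also have "\<dots> \<longleftrightarrow> Z = X \<otimes>\<^bsub>G\<^esub> Y"
  proof
    assume "\<exists>x y z. x \<in> X \<and> y \<in> Y \<and> z \<in> Z \<and> z \<in> prod_set x y"
    then obtain a b c where "a \<in> X" "b \<in> Y" "c \<in> Z" "c \<in> prod_set a b" by blast
    moreover from this have "a \<in> carrier L" "proj H a = X" "b \<in> carrier L" "proj H b = Y" "proj H c = Z"
      using mem by blast+
    ultimately show "Z = X \<otimes>\<^bsub>G\<^esub> Y" using prod_setD(2)[of a b c] by simp
  next
    assume Z: "Z = X \<otimes>\<^bsub>G\<^esub> Y"
    obtain w where "w \<in> prod_set x y" using prod_set_nonempty x(1) y(1) by blast
    then have "w \<in> carrier L" "proj H w = Z"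
      using prod_setD(1,2)[OF x(1) y(1)] x(2) y(2) Z by simp_all
    then have "w \<in> Z" using mem(3) by blast
    then show "\<exists>x y z. x \<in> X \<and> y \<in> Y \<and> z \<in> Z \<and> z \<in> prod_set x y"
      using \<open>w \<in> prod_set x y\<close> \<open>x \<in> X\<close> \<open>y \<in> Y\<close> by blast
  qed
  finally show ?thesis using assms by (simp add: coset_mm_def cosets_L Let_def)
qed

lemma floor_coset_mm_L: "floor_mm (coset_mm L K) = mm_of_group G"
proof -
  have C: "carrier (coset_mm L K) = carrier G"
    by (simp add: coset_mm_def cosets_L Let_def)
  have "fusion (coset_mm L K) X Y Z = 0"
    if "\<not> (X \<in> carrier G \<and> Y \<in> carrier G \<and> Z \<in> carrier G)" for X Y Z
    using that by (auto simp: coset_mm_def cosets_L Let_def)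
  then have "fusion (coset_mm L K) X Y Z > 0 \<longleftrightarrow>
      Z \<in> (if X \<in> carrier G \<and> Y \<in> carrier G then {X \<otimes>\<^bsub>G\<^esub> Y} else {})" for X Y Z
    using coset_mm_fusion[of X Y Z]
    by (cases "X \<in> carrier G \<and> Y \<in> carrier G \<and> Z \<in> carrier G") auto
  then have "floor_set (fusion (coset_mm L K) X Y) =
      (if X \<in> carrier G \<and> Y \<in> carrier G then {X \<otimes>\<^bsub>G\<^esub> Y} else {})" for X Y
    by (simp add: floor_set_def)
  then show ?thesis
    using C by (intro multimagma.equality ext) (simp_all add: floor_mm_def mm_of_group_def)
qed

lemma univ_grading_group_L: "univ_grading_group L = G"
  by (simp add: univ_grading_group_def adjoint_subrule_L floor_coset_mm_L
      group_of_mm_of_group G.group_axioms ext_G)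

lemma serf_group_L: "serf_group L = S"
  by (simp add: serf_group_def sub_mm_serfs_L group_of_mm_of_group S.group_axioms ext_S)

lemma Gamma_Phi_ob: "Gamma_ob L = H"
proof -
  have "restrict (univ_grading L) (carrier S) = restrict u (carrier S)"
    by (rule restrict_ext) (simp add: univ_grading_L serf_in_L proj_serf)
  also have "\<dots> = u" using ext_u by (rule extensional_restrict)
  finally show ?thesis
    by (simp add: Gamma_ob_def serf_group_L univ_grading_group_L serfs_L)
qed

end

section \<open>Inverting a functor\<close>

lemma category_Ident: "\<lbrakk>category C; X \<in> Ob C\<rbrakk> \<Longrightarrow> Ident C X \<in> Hom C X X"
  unfolding category_def by (elim conjE bspec)

lemma category_Comp:
  assumes "category C" "X \<in> Ob C" "Y \<in> Ob C" "Z \<in> Ob C" "f \<in> Hom C X Y" "g \<in> Hom C Y Z"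
  shows "Comp C X Y Z g f \<in> Hom C X Z"
proof -
  have "\<forall>X\<in>Ob C. \<forall>Y\<in>Ob C. \<forall>Z\<in>Ob C. \<forall>f\<in>Hom C X Y. \<forall>g\<in>Hom C Y Z. Comp C X Y Z g f \<in> Hom C X Z"
    using assms(1) unfolding category_def by (elim conjE)
  then show ?thesis using assms(2-) by simp
qed

text \<open>
  Only \<open>F\<close> has to be a functor. The functor laws of \<open>F'\<close> hold because every datum of \<open>D\<close> is the image
  of a datum of \<open>C\<close> under \<open>F\<close>, which \<open>F'\<close> recovers.
\<close>

lemma mutually_inverse_isosI:
  assumes F: "is_functor C D F"
    and ob: "\<And>X. X \<in> Ob C \<Longrightarrow> on_ob F' (on_ob F X) = X"
    and surj: "\<And>Y. Y \<in> Ob D \<Longrightarrow> \<exists>X\<in>Ob C. on_ob F X = Y"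
    and hom: "\<And>X Y f. \<lbrakk>X \<in> Ob C; Y \<in> Ob C; f \<in> Hom C X Y\<rbrakk>
      \<Longrightarrow> on_hom F' (on_ob F X) (on_ob F Y) (on_hom F X Y f) = f"
    and full: "\<And>X Y t. \<lbrakk>X \<in> Ob C; Y \<in> Ob C; t \<in> Hom D (on_ob F X) (on_ob F Y)\<rbrakk>
      \<Longrightarrow> \<exists>f\<in>Hom C X Y. on_hom F X Y f = t"
    and C: "category C"
  shows "mutually_inverse_isos C D F F'"
proof -
  note F_def = F[unfolded is_functor_def]
  have "is_functor D C F'"
    unfolding is_functor_def
  proof (intro conjI ballI)
    fix Y assume "Y \<in> Ob D"
    then obtain X where X: "X \<in> Ob C" "Y = on_ob F X" using surj by blast
    then show "on_ob F' Y \<in> Ob C" by (simp add: ob)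
    have id: "Ident C X \<in> Hom C X X" by (rule category_Ident[OF C X(1)])
    have "Ident D Y = on_hom F X X (Ident C X)" using F_def X by simp
    then show "on_hom F' Y Y (Ident D Y) = Ident C (on_ob F' Y)"
      using hom[OF X(1) X(1) id] X by (simp add: ob)
  next
    fix Y Y' t assume "Y \<in> Ob D" "Y' \<in> Ob D" and t: "t \<in> Hom D Y Y'"
    then obtain X X' where X: "X \<in> Ob C" "Y = on_ob F X" "X' \<in> Ob C" "Y' = on_ob F X'"
      using surj by metis
    then obtain f where "f \<in> Hom C X X'" "on_hom F X X' f = t" using full t by metis
    then show "on_hom F' Y Y' t \<in> Hom C (on_ob F' Y) (on_ob F' Y')"
      using X hom ob by metis
  next
    fix Y1 Y2 Y3 s t
    assume "Y1 \<in> Ob D" "Y2 \<in> Ob D" "Y3 \<in> Ob D" and st: "s \<in> Hom D Y1 Y2" "t \<in> Hom D Y2 Y3"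
    then obtain X1 X2 X3 where X: "X1 \<in> Ob C" "X2 \<in> Ob C" "X3 \<in> Ob C"
      and Y: "Y1 = on_ob F X1" "Y2 = on_ob F X2" "Y3 = on_ob F X3"
      using surj by metis
    obtain f where f: "f \<in> Hom C X1 X2" "s = on_hom F X1 X2 f" using full[OF X(1,2)] st Y by metis
    obtain g where g: "g \<in> Hom C X2 X3" "t = on_hom F X2 X3 g" using full[OF X(2,3)] st Y by metis
    have gf: "Comp C X1 X2 X3 g f \<in> Hom C X1 X3"
      by (rule category_Comp[OF C X f(1) g(1)])
    have "Comp D Y1 Y2 Y3 t s = on_hom F X1 X3 (Comp C X1 X2 X3 g f)"
      using F_def X f g Y by simp
    then show "on_hom F' Y1 Y3 (Comp D Y1 Y2 Y3 t s) =
        Comp C (on_ob F' Y1) (on_ob F' Y2) (on_ob F' Y3) (on_hom F' Y2 Y3 t) (on_hom F' Y1 Y2 s)"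
      using hom[OF X(1,3) gf] hom[OF X(1,2) f(1)] hom[OF X(2,3) g(1)] X Y f(2) g(2)
      by (simp add: ob)
  qed
  moreover have "left_inverse C F F'"
    using ob hom by (simp add: left_inverse_def)
  moreover have "left_inverse D F' F"
    unfolding left_inverse_def
  proof (intro conjI ballI)
    fix Y assume "Y \<in> Ob D"
    then obtain X where "X \<in> Ob C" "Y = on_ob F X" using surj by blast
    then show "on_ob F (on_ob F' Y) = Y" by (simp add: ob)
  next
    fix Y Y' t assume "Y \<in> Ob D" "Y' \<in> Ob D" and t: "t \<in> Hom D Y Y'"
    then obtain X X' where X: "X \<in> Ob C" "X' \<in> Ob C" and Y: "Y = on_ob F X" "Y' = on_ob F X'"
      using surj by metis
    obtain f where "f \<in> Hom C X X'" "t = on_hom F X X' f" using full[OF X] t Y by metis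
    then show "on_hom F (on_ob F' Y) (on_ob F' Y') (on_hom F' Y Y' t) = t"
      using hom[OF X] X Y by (simp add: ob)
  qed
  ultimately show ?thesis using F by (simp add: mutually_inverse_isos_def)
qed

lemma mutually_inverse_isos_sym:
  "mutually_inverse_isos C D F F' \<Longrightarrow> mutually_inverse_isos D C F' F"
  by (simp add: mutually_inverse_isos_def)

section \<open>The two categories\<close>

lemma graded_homD:
  assumes "t \<in> graded_hom L L'"
  shows "t \<in> carrier L \<rightarrow> carrier L'" and "t \<in> extensional (carrier L)"
    and "\<lbrakk>x \<in> carrier L; y \<in> carrier L; z \<in> floor_set (fusion L x y)\<rbrakk>
      \<Longrightarrow> t z \<in> floor_set (fusion L' (t x) (t y))"
    and "x \<in> carrier L \<Longrightarrow> grade L' (t x) = grade L x"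
proof -
  have t: "t \<in> mm_hom L L'" "t \<in> extensional (carrier L)" "\<forall>x\<in>carrier L. grade L' (t x) = grade L x"
    using assms by (simp_all add: graded_hom_def)
  then show "t \<in> extensional (carrier L)" by simp
  show "t \<in> carrier L \<rightarrow> carrier L'" using t(1) by (simp add: mm_hom_def)
  show "x \<in> carrier L \<Longrightarrow> grade L' (t x) = grade L x" using t(3) by simp
  assume "x \<in> carrier L" "y \<in> carrier L" "z \<in> floor_set (fusion L x y)"
  moreover from this have "t ` floor_set (fusion L x y) \<subseteq> floor_set (fusion L' (t x) (t y))"
    using t(1) by (simp add: mm_hom_def)
  ultimately show "t z \<in> floor_set (fusion L' (t x) (t y))" by blast
qed

lemma graded_homI:
  assumes "\<And>x. x \<in> carrier L \<Longrightarrow> t x \<in> carrier L'" and "t \<in> extensional (carrier L)"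
    and "\<And>x y z. \<lbrakk>x \<in> carrier L; y \<in> carrier L; z \<in> floor_set (fusion L x y)\<rbrakk>
      \<Longrightarrow> t z \<in> floor_set (fusion L' (t x) (t y))"
    and "\<And>x. x \<in> carrier L \<Longrightarrow> grade L' (t x) = grade L x"
  shows "t \<in> graded_hom L L'"
  using assms by (auto simp: graded_hom_def mm_hom_def)

lemma feudal_rule_multimagma: "feudal_rule L \<Longrightarrow> multimagma L"
  by (simp add: feudal_rule_def fusion_rule_def)

lemma multimagma_fusion_closed: "\<lbrakk>multimagma L; z \<in> floor_set (fusion L x y)\<rbrakk> \<Longrightarrow> z \<in> carrier L"
  unfolding multimagma_def floor_set_def by blast

lemma category_catL: "category (catL :: ('a feudal, 'a \<Rightarrow> 'a) cat)"
  unfolding category_def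
proof (intro conjI ballI)
  fix X :: "'a feudal" assume "X \<in> Ob catL"
  then have "multimagma X" by (simp add: catL_def feudal_rule_multimagma)
  then show "Ident catL X \<in> Hom catL X X"
    by (auto simp: catL_def multimagma_fusion_closed intro!: graded_homI)
next
  fix X Y Z :: "'a feudal" and f g
  assume "X \<in> Ob catL" and f: "f \<in> Hom catL X Y" and g: "g \<in> Hom catL Y Z"
  then have X: "multimagma X" and f: "f \<in> graded_hom X Y" and g: "g \<in> graded_hom Y Z"
    by (simp_all add: catL_def feudal_rule_multimagma)
  have "compose (carrier X) g f \<in> graded_hom X Z"
  proof (rule graded_homI)
    fix x y z assume xyz: "x \<in> carrier X" "y \<in> carrier X" "z \<in> floor_set (fusion X x y)"
    have "f x \<in> carrier Y" "f y \<in> carrier Y" using xyz graded_homD(1)[OF f] by auto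
    then show "compose (carrier X) g f z \<in>
        floor_set (fusion Z (compose (carrier X) g f x) (compose (carrier X) g f y))"
      using xyz graded_homD(3)[OF f xyz] graded_homD(3)[OF g]
      by (simp add: compose_eq multimagma_fusion_closed[OF X])
  next
    fix x assume x: "x \<in> carrier X"
    then have fx: "f x \<in> carrier Y" using graded_homD(1)[OF f] by auto
    then show "compose (carrier X) g f x \<in> carrier Z"
      using x graded_homD(1)[OF g] by (auto simp: compose_eq)
    show "grade Z (compose (carrier X) g f x) = grade X x"
      using x fx graded_homD(4)[OF f] graded_homD(4)[OF g] by (simp add: compose_eq)
  qed simp
  then show "Comp catL X Y Z g f \<in> Hom catL X Z" by (simp add: catL_def)
next
  fix X Y :: "'a feudal" and f assume "f \<in> Hom catL X Y"
  then have "f \<in> carrier X \<rightarrow> carrier Y" "f \<in> extensional (carrier X)"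
    by (simp_all add: catL_def graded_homD)
  then show "Comp catL X X Y f (Ident catL X) = f" "Comp catL X Y Y (Ident catL Y) f = f"
    by (simp_all add: catL_def compose_Id Id_compose)
next
  fix W X Y Z :: "'a feudal" and f g h
  assume "f \<in> Hom catL W X"
  then have "f \<in> carrier W \<rightarrow> carrier X" by (simp add: catL_def graded_homD)
  then show "Comp catL W Y Z h (Comp catL W X Y g f) = Comp catL W X Z (Comp catL X Y Z h g) f"
    by (simp add: catL_def compose_assoc)
qed

lemma hmorphismsD:
  assumes "h \<in> hmorphisms H H'"
  shows "fst h \<in> hom (src H) (src H')" and "fst h \<in> extensional (carrier (src H))"
    and "snd h \<in> hom (tgt H) (tgt H')" and "snd h \<in> extensional (carrier (tgt H))"
    and "a \<in> carrier (src H) \<Longrightarrow> snd h (hmap H a) = hmap H' (fst h a)"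
    and "X \<in> carrier (tgt H) - him H \<Longrightarrow> snd h X \<in> carrier (tgt H') - him H'"
  using assms by (auto simp: hmorphisms_def)

lemma hmorphismsI:
  assumes "fst h \<in> hom (src H) (src H')" and "fst h \<in> extensional (carrier (src H))"
    and "snd h \<in> hom (tgt H) (tgt H')" and "snd h \<in> extensional (carrier (tgt H))"
    and "\<And>a. a \<in> carrier (src H) \<Longrightarrow> snd h (hmap H a) = hmap H' (fst h a)"
    and "\<And>X. \<lbrakk>X \<in> carrier (tgt H); X \<notin> him H\<rbrakk> \<Longrightarrow> snd h X \<in> carrier (tgt H') - him H'"
  shows "h \<in> hmorphisms H H'"
  using assms by (cases h) (auto simp: hmorphisms_def)

lemma hom_compose_restricted:
  assumes "group G" "f \<in> hom G G'" "g \<in> hom G' G''"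
  shows "compose (carrier G) g f \<in> hom G G''"
proof -
  interpret group G by fact
  show ?thesis
    using assms(2,3) by (auto simp: hom_def compose_eq Pi_iff)
qed

lemma category_catH: "category (catH :: ('a hobj, ('a \<Rightarrow> 'a) \<times> ('a set \<Rightarrow> 'a set)) cat)"
  unfolding category_def
proof (intro conjI ballI)
  fix X :: "'a hobj" assume "X \<in> Ob catH"
  then interpret index_two_hom X by unfold_locales (simp add: catH_def)
  have "u a \<in> carrier G" if "a \<in> carrier S" for a using that by simp
  then show "Ident catH X \<in> Hom catH X X"
    by (auto simp: catH_def hom_def intro!: hmorphismsI)
next
  fix X Y Z :: "'a hobj" and f g
  assume "X \<in> Ob catH" and "f \<in> Hom catH X Y" and "g \<in> Hom catH Y Z"
  then have X: "hobject X" and f: "f \<in> hmorphisms X Y" and g: "g \<in> hmorphisms Y Z"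
    by (simp_all add: catH_def)
  interpret index_two_hom X by unfold_locales (fact X)
  note fs = hmorphismsD[OF f] and gs = hmorphismsD[OF g]
  have "(compose (carrier S) (fst g) (fst f), compose (carrier G) (snd g) (snd f)) \<in> hmorphisms X Z"
  proof (rule hmorphismsI; unfold fst_conv snd_conv)
    show "compose (carrier S) (fst g) (fst f) \<in> hom S (src Z)"
      by (rule hom_compose_restricted[OF S.group_axioms fs(1) gs(1)])
    show "compose (carrier G) (snd g) (snd f) \<in> hom G (tgt Z)"
      by (rule hom_compose_restricted[OF G.group_axioms fs(3) gs(3)])
    show "compose (carrier G) (snd g) (snd f) (u a) = hmap Z (compose (carrier S) (fst g) (fst f) a)"
      if a: "a \<in> carrier S" for a
      using a fs(5)[OF a] gs(5)[OF hom_in_carrier[OF fs(1) a]] by (simp add: compose_eq)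
    show "compose (carrier G) (snd g) (snd f) x \<in> carrier (tgt Z) - him Z"
      if "x \<in> carrier G" "x \<notin> him X" for x
      using that fs(6)[of x] gs(6)[of "snd f x"] by (simp add: compose_eq)
  qed simp_all
  then show "Comp catH X Y Z g f \<in> Hom catH X Z" by (simp add: catH_def)
next
  fix X Y :: "'a hobj" and f assume "f \<in> Hom catH X Y"
  then have f: "f \<in> hmorphisms X Y" by (simp add: catH_def)
  then have "fst f \<in> carrier (src X) \<rightarrow> carrier (src Y)" "snd f \<in> carrier (tgt X) \<rightarrow> carrier (tgt Y)"
    using hmorphismsD(1,3)[OF f] by (simp_all add: hom_def)
  then show "Comp catH X X Y f (Ident catH X) = f" "Comp catH X Y Y (Ident catH Y) f = f"
    using hmorphismsD(2,4)[OF f] by (simp_all add: catH_def compose_Id Id_compose)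
next
  fix W X Y Z :: "'a hobj" and f g h
  assume "f \<in> Hom catH W X"
  then have f: "f \<in> hmorphisms W X" by (simp add: catH_def)
  then have "fst f \<in> carrier (src W) \<rightarrow> carrier (src X)" "snd f \<in> carrier (tgt W) \<rightarrow> carrier (tgt X)"
    using hmorphismsD(1,3)[OF f] by (simp_all add: hom_def)
  then show "Comp catH W Y Z h (Comp catH W X Y g f) = Comp catH W X Z (Comp catH X Y Z h g) f"
    by (simp add: catH_def compose_assoc)
qed

section \<open>Morphisms under the functors\<close>

locale index_two_hom_pair = A: index_two_hom H + B: index_two_hom H'
  for H H' :: "'a hobj"
begin

text \<open>
  \<open>Phi_hom\<close> extracts the image of a lord from a singleton; this characterization avoids that.
\<close>

lemma Phi_hom_eqI:
  assumes "h \<in> hmorphisms H H'" "t \<in> extensional (carrier A.L)"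
    and "\<And>a. a \<in> carrier A.S \<Longrightarrow> t a = fst h a"
    and "\<And>m. \<lbrakk>m \<in> carrier A.L; m \<notin> carrier A.S\<rbrakk> \<Longrightarrow> {t m} = snd h {m}"
  shows "Phi_hom H H' h = t"
proof (rule extensionalityI[OF _ assms(2)])
  show "Phi_hom H H' h \<in> extensional (carrier A.L)"
    by (simp add: Phi_hom_def A.carrier_L)
  fix x assume x: "x \<in> carrier A.L"
  show "Phi_hom H H' h x = t x"
  proof (cases "x \<in> carrier A.S")
    case True
    then show ?thesis using assms(3) by (simp add: Phi_hom_def)
  next
    case False
    then have "snd h {x} = {t x}" using assms(4) x by simp
    then show ?thesis using x False by (simp add: Phi_hom_def A.carrier_L)
  qed
qed

context
  fixes h assumes h: "h \<in> hmorphisms H H'"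
begin

lemma Phi_hom_serf: "a \<in> carrier A.S \<Longrightarrow> Phi_hom H H' h a = fst h a"
  by (simp add: Phi_hom_def)

lemma Phi_hom_serf_closed: "a \<in> carrier A.S \<Longrightarrow> Phi_hom H H' h a \<in> carrier B.S"
  using hmorphismsD(1)[OF h] by (simp add: Phi_hom_serf hom_in_carrier)

text \<open>
  A morphism of objects sends outsiders to outsiders, and outsiders are singletons of lords.
\<close>

lemma Phi_hom_lord:
  assumes "m \<in> carrier A.L" "m \<notin> carrier A.S"
  shows "Phi_hom H H' h m \<in> hlords H'" and "{Phi_hom H H' h m} = snd h {m}"
proof -
  have m: "m \<in> hlords H" using assms A.hlord_iff by simp
  then have "{m} \<in> carrier A.G - him H" using A.hlordsD by simp
  then have "snd h {m} \<in> carrier B.G" "snd h {m} \<notin> him H'" using hmorphismsD(6)[OF h] by blast+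
  then obtain n where "snd h {m} = {n}" "n \<in> hlords H'" using B.outsider_singleton by metis
  then show "Phi_hom H H' h m \<in> hlords H'" "{Phi_hom H H' h m} = snd h {m}"
    using m assms(2) by (simp_all add: Phi_hom_def)
qed

lemma Phi_hom_closed:
  assumes "x \<in> carrier A.L"
  shows "Phi_hom H H' h x \<in> carrier B.L"
    and "Phi_hom H H' h x \<in> carrier B.S \<longleftrightarrow> x \<in> carrier A.S"
  using assms Phi_hom_serf_closed Phi_hom_lord(1) B.hlordsD(3) B.carrier_L
  by (cases "x \<in> carrier A.S"; blast)+

lemma proj_Phi_hom:
  assumes "x \<in> carrier A.L"
  shows "proj H' (Phi_hom H H' h x) = snd h (proj H x)"
proof (cases "x \<in> carrier A.S")
  case True
  then show ?thesis
    using hmorphismsD(5)[OF h True] Phi_hom_serf_closed[OF True] by (simp add: proj_serf Phi_hom_serf)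
next
  case False
  then show ?thesis
    using Phi_hom_lord(2)[OF assms False] Phi_hom_closed(2)[OF assms] by (simp add: proj_lord)
qed

lemma Phi_hom_graded: "Phi_hom H H' h \<in> graded_hom A.L B.L"
proof (rule graded_homI)
  show "Phi_hom H H' h \<in> extensional (carrier A.L)"
    by (simp add: Phi_hom_def A.carrier_L)
  fix x assume x: "x \<in> carrier A.L"
  show "Phi_hom H H' h x \<in> carrier B.L" by (rule Phi_hom_closed(1)[OF x])
  show "grade B.L (Phi_hom H H' h x) = grade A.L x"
    using x Phi_hom_closed[OF x] by (simp add: A.grade_L B.grade_L)
  fix y z assume y: "y \<in> carrier A.L" and "z \<in> floor_set (fusion A.L x y)"
  then have z: "z \<in> A.prod_set x y" using x by (simp add: A.fusion_L)
  have "Phi_hom H H' h z \<in> B.prod_set (Phi_hom H H' h x) (Phi_hom H H' h y)"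
  proof (cases "x \<in> carrier A.S \<and> y \<in> carrier A.S")
    case True
    then show ?thesis
      using z hom_mult[OF hmorphismsD(1)[OF h]]
      by (simp add: A.prod_set_serfs B.prod_set_serfs Phi_hom_serf_closed)
        (simp add: Phi_hom_serf)
  next
    case False
    have zL: "z \<in> carrier A.L" using A.prod_setD(1)[OF x y z] .
    have "proj H' (Phi_hom H H' h z) = proj H' (Phi_hom H H' h x) \<otimes>\<^bsub>B.G\<^esub> proj H' (Phi_hom H H' h y)"
      using A.prod_setD(2)[OF x y z] hom_mult[OF hmorphismsD(3)[OF h]] A.proj_closed x y zL
      by (simp add: proj_Phi_hom)
    then show ?thesis
      using B.mem_prod_set_iff[of "Phi_hom H H' h x" "Phi_hom H H' h y" "Phi_hom H H' h z"]
        Phi_hom_closed[OF x] Phi_hom_closed[OF y] Phi_hom_closed[OF zL] False by simp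
  qed
  then show "Phi_hom H H' h z \<in> floor_set (fusion B.L (Phi_hom H H' h x) (Phi_hom H H' h y))"
    using x y by (simp add: B.fusion_L Phi_hom_closed)
qed

end

context
  fixes t assumes t: "t \<in> graded_hom A.L B.L"
begin

lemma graded_hom_closed: "x \<in> carrier A.L \<Longrightarrow> t x \<in> carrier B.L"
  using graded_homD(1)[OF t] by auto

lemma graded_hom_serf_iff: "x \<in> carrier A.L \<Longrightarrow> t x \<in> carrier B.S \<longleftrightarrow> x \<in> carrier A.S"
  using graded_homD(4)[OF t] graded_hom_closed
  by (fastforce simp: A.grade_L B.grade_L split: if_splits)

lemma graded_hom_prod_set:
  assumes "x \<in> carrier A.L" "y \<in> carrier A.L" "z \<in> A.prod_set x y"
  shows "t z \<in> B.prod_set (t x) (t y)"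
  using graded_homD(3)[OF t assms(1,2)] assms graded_hom_closed by (simp add: A.fusion_L B.fusion_L)

lemma graded_hom_serf_mult:
  "\<lbrakk>a \<in> carrier A.S; b \<in> carrier A.S\<rbrakk> \<Longrightarrow> t (a \<otimes>\<^bsub>A.S\<^esub> b) = t a \<otimes>\<^bsub>B.S\<^esub> t b"
  using graded_hom_prod_set[of a b "a \<otimes>\<^bsub>A.S\<^esub> b"]
  by (simp add: A.serf_in_L A.prod_set_serfs B.prod_set_serfs graded_hom_serf_iff)

lemma proj_graded_hom_mult:
  assumes "x \<in> carrier A.L" "y \<in> carrier A.L" "z \<in> A.prod_set x y"
  shows "proj H' (t z) = proj H' (t x) \<otimes>\<^bsub>B.G\<^esub> proj H' (t y)"
  using B.prod_setD(2)[OF _ _ graded_hom_prod_set[OF assms]] assms graded_hom_closed by simp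

text \<open>
  The reason why a graded homomorphism \<open>t\<close> induces a map of the groups \<open>G\<close>: two serfs in the same
  fibre act alike on a lord \<open>m\<close>, hence so do their images on \<open>t m\<close>, and in a group such an action
  determines the acting element. A lord is alone in its fibre.
\<close>

lemma proj_graded_hom_cong:
  assumes x: "x \<in> carrier A.L" "y \<in> carrier A.L" and eq: "proj H x = proj H y"
  shows "proj H' (t x) = proj H' (t y)"
proof (cases "x \<in> carrier A.S")
  case True
  then have y: "y \<in> carrier A.S" using A.proj_in_him_iff x eq by metis
  \<comment> \<open>The lord \<open>l = xm = ym\<close> is a common product, whose image is computed in two ways.\<close>
  obtain m where m: "m \<in> carrier A.L" "m \<notin> carrier A.S"
    using A.lord_exists A.hlordsD(3) A.carrier_L by blast
  obtain l where l: "l \<in> carrier A.L" "proj H l = proj H x \<otimes>\<^bsub>A.G\<^esub> proj H m"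
    using A.proj_surj[of "proj H x \<otimes>\<^bsub>A.G\<^esub> proj H m"] A.proj_closed x m by auto
  have "l \<in> A.prod_set x m" "l \<in> A.prod_set y m"
    using A.mem_prod_set_iff[of x m l] A.mem_prod_set_iff[of y m l] x m l eq by simp_all
  then have "proj H' (t x) \<otimes>\<^bsub>B.G\<^esub> proj H' (t m) = proj H' (t y) \<otimes>\<^bsub>B.G\<^esub> proj H' (t m)"
    using proj_graded_hom_mult x m by metis
  then show ?thesis using x m by (simp add: B.proj_closed graded_hom_closed)
next
  case False
  then show ?thesis using A.proj_lord_eq x eq by metis
qed

lemma Gamma_hom_L:
  "Gamma_hom A.L B.L t = (restrict t (carrier A.S),
    \<lambda>X\<in>carrier A.G. THE Y. \<forall>x\<in>X. univ_grading B.L (t x) = Y)"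
  by (simp add: Gamma_hom_def A.serfs_L A.univ_grading_group_L)

lemma Gamma_hom_proj:
  assumes "x \<in> carrier A.L"
  shows "snd (Gamma_hom A.L B.L t) (proj H x) = proj H' (t x)"
proof -
  have "univ_grading B.L (t y) = proj H' (t x)" if "y \<in> proj H x" for y
  proof -
    have y: "y \<in> carrier A.L" "proj H y = proj H x"
      using that A.mem_proj_iff[OF assms] by simp_all
    then show ?thesis
      using proj_graded_hom_cong[OF y(1) assms y(2)]
      by (simp add: B.univ_grading_L graded_hom_closed)
  qed
  moreover have "x \<in> proj H x" using A.mem_proj_iff[OF assms] assms by simp
  ultimately have "(THE Y. \<forall>y\<in>proj H x. univ_grading B.L (t y) = Y) = proj H' (t x)"
    by (intro the_equality) auto
  then show ?thesis using assms A.proj_closed by (simp add: Gamma_hom_L)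
qed

text \<open>
  Multiplicativity of the induced map: represent two elements of \<open>G\<close> by \<open>x\<close> and \<open>y\<close> and choose any \<open>z\<close>
  in their product; then \<open>t z\<close> lies in the product of \<open>t x\<close> and \<open>t y\<close>.
\<close>

lemma Gamma_hom_hmorphism: "Gamma_hom A.L B.L t \<in> hmorphisms H H'"
proof (rule hmorphismsI)
  let ?h = "Gamma_hom A.L B.L t"
  have fst_h: "fst ?h = restrict t (carrier A.S)" by (simp add: Gamma_hom_L)
  have serf: "t a \<in> carrier B.S" if "a \<in> carrier A.S" for a
    using that graded_hom_serf_iff A.serf_in_L by simp
  show "fst ?h \<in> hom A.S B.S"
    using serf graded_hom_serf_mult by (auto simp: fst_h hom_def)
  show "fst ?h \<in> extensional (carrier A.S)" "snd ?h \<in> extensional (carrier A.G)"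
    by (simp_all add: Gamma_hom_L)
  show "snd ?h (A.u a) = B.u (fst ?h a)" if "a \<in> carrier A.S" for a
    using Gamma_hom_proj[OF A.serf_in_L[OF that]] that serf[OF that]
    by (simp add: proj_serf fst_h)
  show "snd ?h X \<in> carrier B.G - him H'" if "X \<in> carrier A.G" "X \<notin> him H" for X
  proof -
    from that(1) obtain x where x: "x \<in> carrier A.L" "proj H x = X" by (rule A.proj_surj)
    then have "x \<notin> carrier A.S" using that A.proj_in_him_iff by blast
    then have "proj H' (t x) \<in> carrier B.G - him H'"
      using x(1) B.proj_closed B.proj_in_him_iff graded_hom_closed graded_hom_serf_iff by simp
    then show ?thesis using Gamma_hom_proj x by auto
  qed
  show "snd ?h \<in> hom A.G B.G"
  proof (rule homI)
    fix X assume "X \<in> carrier A.G"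
    then obtain x where x: "x \<in> carrier A.L" "proj H x = X" by (rule A.proj_surj)
    show "snd ?h X \<in> carrier B.G"
      using Gamma_hom_proj[OF x(1)] x B.proj_closed graded_hom_closed by simp
    fix Y assume "Y \<in> carrier A.G"
    then obtain y where y: "y \<in> carrier A.L" "proj H y = Y" by (rule A.proj_surj)
    obtain z where z: "z \<in> A.prod_set x y"
      using A.prod_set_nonempty x(1) y(1) by blast
    have "snd ?h (proj H z) = snd ?h X \<otimes>\<^bsub>B.G\<^esub> snd ?h Y"
      using proj_graded_hom_mult[OF x(1) y(1) z] Gamma_hom_proj x y A.prod_setD(1)[OF x(1) y(1) z]
      by metis
    then show "snd ?h (X \<otimes>\<^bsub>A.G\<^esub> Y) = snd ?h X \<otimes>\<^bsub>B.G\<^esub> snd ?h Y"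
      using A.prod_setD(2)[OF x(1) y(1) z] x y by simp
  qed
qed

lemma Phi_Gamma_hom: "Phi_hom H H' (Gamma_hom A.L B.L t) = t"
proof (rule Phi_hom_eqI[OF Gamma_hom_hmorphism graded_homD(2)[OF t]])
  show "t a = fst (Gamma_hom A.L B.L t) a" if "a \<in> carrier A.S" for a
    using that by (simp add: Gamma_hom_L)
  show "{t m} = snd (Gamma_hom A.L B.L t) {m}" if "m \<in> carrier A.L" "m \<notin> carrier A.S" for m
    using Gamma_hom_proj[OF that(1)] that graded_hom_serf_iff by (simp add: proj_lord)
qed

end

lemma Gamma_Phi_hom:
  assumes h: "h \<in> hmorphisms H H'"
  shows "Gamma_hom A.L B.L (Phi_hom H H' h) = h"
proof (rule prod_eqI)
  note t = Phi_hom_graded[OF h]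
  show "fst (Gamma_hom A.L B.L (Phi_hom H H' h)) = fst h"
    by (rule extensionalityI[of _ "carrier A.S"])
      (simp_all add: Gamma_hom_L[OF t] hmorphismsD(2)[OF h] Phi_hom_serf[OF h])
  show "snd (Gamma_hom A.L B.L (Phi_hom H H' h)) = snd h"
  proof (rule extensionalityI[of _ "carrier A.G"])
    fix X assume "X \<in> carrier A.G"
    then obtain x where "x \<in> carrier A.L" "proj H x = X" by (rule A.proj_surj)
    then show "snd (Gamma_hom A.L B.L (Phi_hom H H' h)) X = snd h X"
      using Gamma_hom_proj[OF t, of x] proj_Phi_hom[OF h, of x] by simp
  qed (simp_all add: Gamma_hom_L[OF t] hmorphismsD(4)[OF h])
qed

end

lemma is_functor_Phi:
  "is_functor (catH :: ('a hobj, ('a \<Rightarrow> 'a) \<times> ('a set \<Rightarrow> 'a set)) cat)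
    (catL :: ('a feudal, 'a \<Rightarrow> 'a) cat) Phi"
  unfolding is_functor_def
proof (intro conjI ballI)
  fix X :: "'a hobj" assume X: "X \<in> Ob catH"
  then interpret index_two_hom_pair X X by unfold_locales (simp_all add: catH_def)
  show "on_ob Phi X \<in> Ob catL"
    using A.feudal_rule_Phi_ob by (simp add: Phi_def catL_def)
  have "Ident catH X \<in> hmorphisms X X"
    using category_Ident[OF category_catH X] by (simp add: catH_def)
  then have "Phi_hom X X (Ident catH X) = (\<lambda>x\<in>carrier A.L. x)"
    by (rule Phi_hom_eqI) (auto simp: catH_def A.serf_in_L A.hlord_iff[symmetric] dest: A.hlordsD(1))
  then show "on_hom Phi X X (Ident catH X) = Ident catL (on_ob Phi X)"
    by (simp add: Phi_def catL_def)
next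
  fix X Y :: "'a hobj" and f
  assume "X \<in> Ob catH" "Y \<in> Ob catH" and f: "f \<in> Hom catH X Y"
  then interpret index_two_hom_pair X Y by unfold_locales (simp_all add: catH_def)
  show "on_hom Phi X Y f \<in> Hom catL (on_ob Phi X) (on_ob Phi Y)"
    using Phi_hom_graded f by (simp add: Phi_def catL_def catH_def)
next
  fix X Y Z :: "'a hobj" and f g
  assume XYZ: "X \<in> Ob catH" "Y \<in> Ob catH" "Z \<in> Ob catH" and f: "f \<in> Hom catH X Y" and g: "g \<in> Hom catH Y Z"
  then interpret XY: index_two_hom_pair X Y + YZ: index_two_hom_pair Y Z + XZ: index_two_hom_pair X Z
    by unfold_locales (simp_all add: catH_def)
  let ?gf = "Comp catH X Y Z g f"
  have gf: "?gf \<in> hmorphisms X Z"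
    using category_Comp[OF category_catH XYZ f g] by (simp add: catH_def)
  have f: "f \<in> hmorphisms X Y" and g: "g \<in> hmorphisms Y Z" using f g by (simp_all add: catH_def)
  have "Phi_hom X Z ?gf = compose (carrier (Phi_ob X)) (Phi_hom Y Z g) (Phi_hom X Y f)"
  proof (rule XZ.Phi_hom_eqI[OF gf])
    fix a assume a: "a \<in> carrier (src X)"
    then show "compose (carrier (Phi_ob X)) (Phi_hom Y Z g) (Phi_hom X Y f) a = fst ?gf a"
      using XY.Phi_hom_serf[OF f a] YZ.Phi_hom_serf[OF g XY.Phi_hom_serf_closed[OF f a]]
      by (simp add: compose_eq XY.A.serf_in_L catH_def)
  next
    fix m assume m: "m \<in> carrier (Phi_ob X)" "m \<notin> carrier (src X)"
    have "{m} \<in> carrier (tgt X)" using m XY.A.hlord_iff XY.A.hlordsD(1) by blast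
    moreover have "{Phi_hom Y Z g (Phi_hom X Y f m)} = snd g {Phi_hom X Y f m}"
      using YZ.Phi_hom_lord(2)[OF g] XY.Phi_hom_closed[OF f m(1)] m(2) by simp
    ultimately show "{compose (carrier (Phi_ob X)) (Phi_hom Y Z g) (Phi_hom X Y f) m} = snd ?gf {m}"
      using m(1) XY.Phi_hom_lord(2)[OF f m] by (simp add: compose_eq catH_def)
  qed simp
  then show "on_hom Phi X Z (Comp catH X Y Z g f) =
      Comp catL (on_ob Phi X) (on_ob Phi Y) (on_ob Phi Z) (on_hom Phi Y Z g) (on_hom Phi X Y f)"
    by (simp add: Phi_def catL_def)
qed

section \<open>Calculus of fusion rules\<close>

text \<open>
  Products of sets turn the supports of a fusion rule into an associative calculus; multiplicities are
  needed only to see that invertible elements act by maps and that lords have products free of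
  multiplicities.
\<close>

locale fusion_structure =
  fixes L :: "('a, 'b) multimagma_scheme"
  assumes fusion_rule: "fusion_rule L"
begin

abbreviation P where "P x y \<equiv> floor_set (fusion L x y)"
abbreviation e where "e \<equiv> unit_of L"
abbreviation cj where "cj \<equiv> conj_of L"

lemma multimagma: "multimagma L" and locally_finite: "locally_finite L"
  and assoc: "\<lbrakk>x \<in> carrier L; y \<in> carrier L; z \<in> carrier L\<rbrakk>
    \<Longrightarrow> mprod L (fusion L x y) (ind {z}) = mprod L (ind {x}) (fusion L y z)"
  using fusion_rule by (simp_all add: fusion_rule_def)

lemma unit_and_conj: "is_unit_of L e \<and> (\<forall>x\<in>carrier L. is_conj_of L e x (cj x))"
proof -
  obtain e' where e': "is_unit_of L e'" "\<forall>x\<in>carrier L. \<exists>x'. is_conj_of L e' x x'"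
    using fusion_rule unfolding fusion_rule_def by blast
  have "e = e'" by (rule unit_of_eq[OF e'(1)])
  then have "is_conj_of L e x (cj x)" if "x \<in> carrier L" for x
    using e'(2) that conj_of_eq by metis
  then show ?thesis using e'(1) \<open>e = e'\<close> by simp
qed

lemma is_unit: "is_unit_of L e"
  using unit_and_conj by simp

lemma is_conj: "x \<in> carrier L \<Longrightarrow> is_conj_of L e x (cj x)"
  using unit_and_conj by simp

lemma unit_closed [simp]: "e \<in> carrier L"
  using is_unit by (simp add: is_unit_of_def)

lemma conj_closed [simp]: "x \<in> carrier L \<Longrightarrow> cj x \<in> carrier L"
  using is_conj by (simp add: is_conj_of_def)

lemma fusion_unit:
  assumes "x \<in> carrier L"
  shows "fusion L e x = ind {x}" and "fusion L x e = ind {x}"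
  using is_unit assms by (simp_all add: is_unit_of_def)

lemma fusion_conj:
  assumes "x \<in> carrier L" "y \<in> carrier L"
  shows "fusion L x y e = (if y = cj x then 1 else 0)"
    and "fusion L y x e = (if y = cj x then 1 else 0)"
  using is_conj[OF assms(1)] assms(2) by (simp_all add: is_conj_of_def)

lemma unit_in_P_iff:
  assumes "x \<in> carrier L" "y \<in> carrier L"
  shows "e \<in> P x y \<longleftrightarrow> y = cj x" and "e \<in> P y x \<longleftrightarrow> y = cj x"
  using fusion_conj[OF assms] by (simp_all add: floor_set_def)

lemma conj_conj: "x \<in> carrier L \<Longrightarrow> cj (cj x) = x"
  using unit_in_P_iff(1)[of x "cj x"] unit_in_P_iff(2)[of "cj x" x] by simp

lemma P_closed: "z \<in> P x y \<Longrightarrow> x \<in> carrier L \<and> y \<in> carrier L \<and> z \<in> carrier L"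
  using multimagma unfolding multimagma_def floor_set_def by blast

lemma finite_P: "finite (P x y)"
proof (cases "x \<in> carrier L \<and> y \<in> carrier L")
  case True
  then show ?thesis using locally_finite by (simp add: locally_finite_def)
next
  case False
  then have "P x y = {}" using P_closed by blast
  then show ?thesis by simp
qed

definition sp :: "'a set \<Rightarrow> 'a set \<Rightarrow> 'a set" (infixl "\<bullet>" 70) where
  "A \<bullet> B = (\<Union>a\<in>A. \<Union>b\<in>B. P a b)"

lemma sp_singletons [simp]: "{x} \<bullet> {y} = P x y"
  by (simp add: sp_def)

lemma sp_subset [simp]: "A \<bullet> B \<subseteq> carrier L"
  using P_closed by (auto simp: sp_def)

lemma P_subset [simp]: "P x y \<subseteq> carrier L"
  using P_closed by blast

lemma sp_unit:
  assumes "A \<subseteq> carrier L"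
  shows "{e} \<bullet> A = A" and "A \<bullet> {e} = A"
  using assms by (auto simp: sp_def fusion_unit subset_iff)

lemma mem_assoc:
  assumes "x \<in> carrier L" "y \<in> carrier L" "z \<in> carrier L"
  shows "(\<exists>w\<in>P x y. v \<in> P w z) \<longleftrightarrow> (\<exists>w\<in>P y z. v \<in> P x w)"
proof -
  have "(\<exists>w\<in>P x y. v \<in> P w z) \<longleftrightarrow> (\<Sum>w\<in>P x y. fusion L x y w * fusion L w z v) \<noteq> 0"
    by (simp add: finite_P sum_eq_0_iff) (auto simp: floor_set_def)
  also have "(\<Sum>w\<in>P x y. fusion L x y w * fusion L w z v) =
      (\<Sum>w\<in>P y z. fusion L y z w * fusion L x w v)"
    using fun_cong[OF assoc[OF assms], of v] by (simp add: mprod_ind_left mprod_ind_right)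
  also have "\<dots> \<noteq> 0 \<longleftrightarrow> (\<exists>w\<in>P y z. v \<in> P x w)"
    by (simp add: finite_P sum_eq_0_iff) (auto simp: floor_set_def)
  finally show ?thesis .
qed

lemma sp_assoc:
  assumes "A \<subseteq> carrier L" "B \<subseteq> carrier L" "D \<subseteq> carrier L"
  shows "A \<bullet> B \<bullet> D = A \<bullet> (B \<bullet> D)"
proof (rule Set.set_eqI)
  fix v
  have "v \<in> A \<bullet> B \<bullet> D \<longleftrightarrow> (\<exists>a\<in>A. \<exists>b\<in>B. \<exists>d\<in>D. \<exists>w\<in>P a b. v \<in> P w d)"
    unfolding sp_def by blast
  also have "\<dots> \<longleftrightarrow> (\<exists>a\<in>A. \<exists>b\<in>B. \<exists>d\<in>D. \<exists>w\<in>P b d. v \<in> P a w)"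
    by (intro bex_cong refl mem_assoc) (use assms in auto)
  also have "\<dots> \<longleftrightarrow> v \<in> A \<bullet> (B \<bullet> D)"
    unfolding sp_def by blast
  finally show "v \<in> A \<bullet> B \<bullet> D \<longleftrightarrow> v \<in> A \<bullet> (B \<bullet> D)" .
qed

lemma sp_mono: "\<lbrakk>A \<subseteq> A'; B \<subseteq> B'\<rbrakk> \<Longrightarrow> A \<bullet> B \<subseteq> A' \<bullet> B'"
  unfolding sp_def by blast

text \<open>
  Multiplication by the conjugate of \<open>x\<close> brings \<open>y\<close> back from the product of \<open>x\<close> and \<open>y\<close>.
\<close>

lemma P_nonempty:
  assumes "x \<in> carrier L" "y \<in> carrier L"
  shows "P x y \<noteq> {}"
proof
  assume "P x y = {}"
  then have "{cj x} \<bullet> {x} \<bullet> {y} = {}"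
    using assms by (subst sp_assoc) (simp_all add: sp_def)
  moreover have "{e} \<bullet> {y} \<subseteq> {cj x} \<bullet> {x} \<bullet> {y}"
    using assms unit_in_P_iff(2)[of x "cj x"] by (intro sp_mono) simp_all
  ultimately show False using sp_unit(1)[of "{y}"] assms by simp
qed

text \<open>
  Both sides are the multiplicity of the unit in the product of \<open>x\<close>, \<open>y\<close> and the conjugate of \<open>z\<close>,
  in the two bracketings.
\<close>

lemma rotate:
  assumes "x \<in> carrier L" "y \<in> carrier L" "z \<in> carrier L"
  shows "fusion L x y z = fusion L y (cj z) (cj x)"
proof -
  have "(\<Sum>w\<in>P x y. fusion L x y w * fusion L w (cj z) e) =
      (\<Sum>w\<in>P x y. if w = z then fusion L x y w else 0)"
  proof (intro sum.cong refl)
    fix w assume "w \<in> P x y"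
    then show "fusion L x y w * fusion L w (cj z) e = (if w = z then fusion L x y w else 0)"
      using fusion_conj(2)[of "cj z" w] P_closed conj_conj assms by simp
  qed
  also have "\<dots> = fusion L x y z"
    unfolding sum.delta[OF finite_P] by (simp add: floor_set_def)
  finally have left: "(\<Sum>w\<in>P x y. fusion L x y w * fusion L w (cj z) e) = fusion L x y z" .
  have "(\<Sum>w\<in>P y (cj z). fusion L y (cj z) w * fusion L x w e) =
      (\<Sum>w\<in>P y (cj z). if w = cj x then fusion L y (cj z) w else 0)"
  proof (intro sum.cong refl)
    fix w assume "w \<in> P y (cj z)"
    then show "fusion L y (cj z) w * fusion L x w e = (if w = cj x then fusion L y (cj z) w else 0)"
      using fusion_conj(1)[of x w] P_closed assms by simp
  qed
  also have "\<dots> = fusion L y (cj z) (cj x)"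
    unfolding sum.delta[OF finite_P] by (simp add: floor_set_def)
  finally show ?thesis
    using left fun_cong[OF assoc[of x y "cj z"], of e] assms
    by (simp add: mprod_ind_left mprod_ind_right)
qed

text \<open>
  Count the ways back to \<open>x\<close>: multiplying \<open>gx\<close> by \<open>h\<close> gives \<open>x\<close> exactly once, while every element
  of \<open>gx\<close> leads back to \<open>x\<close> at least once.
\<close>

lemma left_invertible_single:
  assumes gh: "g \<in> carrier L" "h \<in> carrier L" "fusion L h g = ind {e}" and x: "x \<in> carrier L"
  obtains l where "fusion L g x = ind {l}"
proof -
  have sum: "(\<Sum>w\<in>P g x. fusion L g x w * fusion L h w v) = ind {x} v" for v
  proof -
    have "(\<Sum>w\<in>P g x. fusion L g x w * fusion L h w v) = mprod L (fusion L h g) (ind {x}) v"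
      using assoc[OF gh(2,1) x] by (simp add: mprod_ind_left)
    also have "\<dots> = ind {x} v"
      using x by (simp add: gh(3) mprod_ind_right fusion_unit) (simp add: ind_def)
    finally show ?thesis .
  qed
  \<comment> \<open>An element of \<open>gx\<close> leads somewhere, and it can lead only to \<open>x\<close>.\<close>
  have pos: "fusion L g x w * fusion L h w x > 0" if w: "w \<in> P g x" for w
  proof -
    obtain v where v: "v \<in> P h w" using P_nonempty gh(2) w P_closed by blast
    have "fusion L g x w * fusion L h w v > 0" using v w by (simp add: floor_set_def)
    moreover have "fusion L g x w * fusion L h w v \<le> ind {x} v"
      using member_le_sum[OF w, of "\<lambda>w. fusion L g x w * fusion L h w v"] finite_P sum[of v] by simp
    ultimately have "v = x" by (simp add: ind_def split: if_splits)
    then show ?thesis using \<open>fusion L g x w * fusion L h w v > 0\<close> by simp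
  qed
  have sum_x: "(\<Sum>w\<in>P g x. fusion L g x w * fusion L h w x) = 1"
    using sum[of x] by (simp add: ind_def)
  obtain l where l: "P g x = {l}"
    by (rule sum_of_positives_eq_1[OF finite_P P_nonempty[OF gh(1) x] pos sum_x])
  then have "fusion L g x l = 1" using sum_x by simp
  moreover have "fusion L g x w = 0" if "w \<noteq> l" for w
  proof -
    have "w \<notin> P g x" using l that by simp
    then show ?thesis by (simp add: floor_set_def)
  qed
  ultimately have "fusion L g x = ind {l}" by (intro ext) (simp add: ind_def)
  then show thesis by (rule that)
qed

text \<open>
  The mirror image of \<open>left_invertible_single\<close>.
\<close>

lemma right_invertible_single:
  assumes gh: "g \<in> carrier L" "h \<in> carrier L" "fusion L g h = ind {e}" and x: "x \<in> carrier L"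
  obtains l where "fusion L x g = ind {l}"
proof -
  have sum: "(\<Sum>w\<in>P x g. fusion L x g w * fusion L w h v) = ind {x} v" for v
  proof -
    have "(\<Sum>w\<in>P x g. fusion L x g w * fusion L w h v) = mprod L (ind {x}) (fusion L g h) v"
      using assoc[OF x gh(1,2)] by (simp add: mprod_ind_right[symmetric])
    also have "\<dots> = ind {x} v"
      using x by (simp add: gh(3) mprod_ind_left fusion_unit) (simp add: ind_def)
    finally show ?thesis .
  qed
  have pos: "fusion L x g w * fusion L w h x > 0" if w: "w \<in> P x g" for w
  proof -
    obtain v where v: "v \<in> P w h" using P_nonempty gh(2) w P_closed by blast
    have "fusion L x g w * fusion L w h v > 0" using v w by (simp add: floor_set_def)
    moreover have "fusion L x g w * fusion L w h v \<le> ind {x} v"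
      using member_le_sum[OF w, of "\<lambda>w. fusion L x g w * fusion L w h v"] finite_P sum[of v] by simp
    ultimately have "v = x" by (simp add: ind_def split: if_splits)
    then show ?thesis using \<open>fusion L x g w * fusion L w h v > 0\<close> by simp
  qed
  have sum_x: "(\<Sum>w\<in>P x g. fusion L x g w * fusion L w h x) = 1"
    using sum[of x] by (simp add: ind_def)
  obtain l where l: "P x g = {l}"
    by (rule sum_of_positives_eq_1[OF finite_P P_nonempty[OF x gh(1)] pos sum_x])
  then have "fusion L x g l = 1" using sum_x by simp
  moreover have "fusion L x g w = 0" if "w \<noteq> l" for w
  proof -
    have "w \<notin> P x g" using l that by simp
    then show ?thesis by (simp add: floor_set_def)
  qed
  ultimately have "fusion L x g = ind {l}" by (intro ext) (simp add: ind_def)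
  then show thesis by (rule that)
qed

end

section \<open>Serfs and lords\<close>

locale feudal_structure =
  fixes L :: "'a feudal"
  assumes feudal_rule: "feudal_rule L"

sublocale feudal_structure \<subseteq> fusion_structure L
  using feudal_rule by unfold_locales (simp add: feudal_rule_def)

context feudal_structure
begin

lemma grade_values: "x \<in> carrier L \<Longrightarrow> grade L x = 1 \<or> grade L x = -1"
proof -
  have "grade L ` carrier L = {1, -1}"
    using feudal_rule by (simp add: feudal_rule_def grading_def Z2_def)
  then show "x \<in> carrier L \<Longrightarrow> grade L x = 1 \<or> grade L x = -1" by auto
qed

lemma lord_exists: "\<exists>m. m \<in> lords L"
proof -
  have "grade L ` carrier L = {1, -1}"
    using feudal_rule by (simp add: feudal_rule_def grading_def Z2_def)
  then have "-1 \<in> grade L ` carrier L" by simp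
  then show ?thesis by (auto simp: lords_def)
qed

lemma grade_mult:
  assumes z: "z \<in> P x y"
  shows "grade L z = grade L x * grade L y"
proof -
  have xy: "x \<in> carrier L" "y \<in> carrier L" using P_closed z by auto
  have "grade L \<in> mm_hom (floor_mm L) (mm_of_group Z2)"
    using feudal_rule by (simp add: feudal_rule_def grading_def)
  then have "grade L ` P x y \<subseteq> floor_set (fusion (mm_of_group Z2) (grade L x) (grade L y))"
    using xy by (simp add: mm_hom_def floor_mm_def)
  then have "grade L z \<in> floor_set (fusion (mm_of_group Z2) (grade L x) (grade L y))"
    using z by blast
  then show ?thesis
    using grade_values xy by (simp add: mm_of_group_def Z2_def split: if_splits)
qed

lemma carrier_split: "carrier L = serfs L \<union> lords L" and serf_not_lord: "serfs L \<inter> lords L = {}"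
  using grade_values by (auto simp: serfs_def lords_def)

lemma serf_iff_grade: "x \<in> carrier L \<Longrightarrow> x \<in> serfs L \<longleftrightarrow> grade L x = 1"
  by (simp add: serfs_def)

lemma serf_closed [simp]: "a \<in> serfs L \<Longrightarrow> a \<in> carrier L"
  and lord_closed [simp]: "m \<in> lords L \<Longrightarrow> m \<in> carrier L"
  by (simp_all add: carrier_split)

lemma lord_iff: "x \<in> carrier L \<Longrightarrow> x \<in> lords L \<longleftrightarrow> x \<notin> serfs L"
  using carrier_split serf_not_lord by blast

lemma lord_not_serf: "m \<in> lords L \<Longrightarrow> m \<notin> serfs L"
  using serf_not_lord by blast

lemma serf_mult_iff:
  assumes "z \<in> P x y"
  shows "z \<in> serfs L \<longleftrightarrow> (x \<in> serfs L \<longleftrightarrow> y \<in> serfs L)"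
proof -
  have xyz: "x \<in> carrier L" "y \<in> carrier L" "z \<in> carrier L" using P_closed[OF assms] by auto
  have "grade L z = 1 \<longleftrightarrow> (grade L x = 1 \<longleftrightarrow> grade L y = 1)"
    using grade_mult[OF assms] grade_values[OF xyz(1)] grade_values[OF xyz(2)]
    by (elim disjE) simp_all
  then show ?thesis unfolding xyz[THEN serf_iff_grade] .
qed

lemma unit_serf [simp]: "e \<in> serfs L"
  using serf_mult_iff[of e e e] by (simp add: fusion_unit)

lemma conj_serf_iff:
  assumes "x \<in> carrier L"
  shows "cj x \<in> serfs L \<longleftrightarrow> x \<in> serfs L"
  using serf_mult_iff[of e x "cj x"] unit_in_P_iff(1)[of x "cj x"] assms by auto

lemma conj_lord: "m \<in> lords L \<Longrightarrow> cj m \<in> lords L"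
  using conj_serf_iff lord_iff lord_closed conj_closed by metis

abbreviation S where "S \<equiv> serf_group L"

text \<open>
  The serf group is built from the fusion, so it has to be identified with the group that the
  definition of a feudal rule provides. A product of serfs has no further terms outside the serfs,
  because of the grading.
\<close>

lemma serf_group:
  shows group_S: "group S" and ext_S: "ext_mult S" and carrier_S: "carrier S = serfs L"
    and fusion_serfs: "\<lbrakk>a \<in> serfs L; b \<in> serfs L\<rbrakk> \<Longrightarrow> fusion L a b = ind {a \<otimes>\<^bsub>S\<^esub> b}"
proof -
  obtain S0 :: "'a monoid" where S0: "group S0" "sub_mm L (serfs L) = mm_of_group S0"
    using feudal_rule unfolding feudal_rule_def by blast
  then have S: "S = group_of_mm (mm_of_group S0)" by (simp add: serf_group_def)
  show "group S" "ext_mult S" using group_group_of_mm_of_group[OF S0(1)] by (simp_all add: S)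
  have "carrier (sub_mm L (serfs L)) = carrier (mm_of_group S0)" using S0(2) by simp
  then have C: "carrier S0 = serfs L" by (simp add: sub_mm_def mm_of_group_def)
  then show "carrier S = serfs L" by (simp add: S carrier_group_of_mm_of_group[OF S0(1)])
  show "fusion L a b = ind {a \<otimes>\<^bsub>S\<^esub> b}" if ab: "a \<in> serfs L" "b \<in> serfs L"
  proof
    interpret S0: group S0 by (fact S0(1))
    have ab_S: "a \<otimes>\<^bsub>S\<^esub> b = a \<otimes>\<^bsub>S0\<^esub> b" "a \<otimes>\<^bsub>S0\<^esub> b \<in> serfs L"
      using ab S0.m_closed[of a b] C by (simp_all add: S mult_group_of_mm_of_group[OF S0(1)])
    fix z
    have "fusion (sub_mm L (serfs L)) a b z = fusion (mm_of_group S0) a b z" using S0(2) by simp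
    then have eq: "(if z \<in> serfs L then fusion L a b z else 0) = ind {a \<otimes>\<^bsub>S0\<^esub> b} z"
      using ab C by (simp add: sub_mm_def mm_of_group_def)
    show "fusion L a b z = ind {a \<otimes>\<^bsub>S\<^esub> b} z"
    proof (cases "z \<in> serfs L")
      case True
      then show ?thesis using eq ab_S by simp
    next
      case False
      then have "z \<notin> P a b" using serf_mult_iff ab by blast
      then show ?thesis using False ab_S by (auto simp: floor_set_def ind_def)
    qed
  qed
qed

end

sublocale feudal_structure \<subseteq> S: group "serf_group L"
  by (rule group_S)

context feudal_structure
begin

lemma P_serfs: "\<lbrakk>a \<in> serfs L; b \<in> serfs L\<rbrakk> \<Longrightarrow> P a b = {a \<otimes>\<^bsub>S\<^esub> b}"
  by (simp add: fusion_serfs)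

lemma one_S: "\<one>\<^bsub>S\<^esub> = e"
proof -
  have "e \<otimes>\<^bsub>S\<^esub> e = e"
    using P_serfs[of e e] by (simp add: fusion_unit)
  then show ?thesis by (simp add: carrier_S)
qed

lemma inv_serf [simp]: "a \<in> serfs L \<Longrightarrow> inv\<^bsub>S\<^esub> a \<in> serfs L"
  using S.inv_closed carrier_S by simp

lemma fusion_inv_serf:
  assumes "a \<in> serfs L"
  shows "fusion L a (inv\<^bsub>S\<^esub> a) = ind {e}" and "fusion L (inv\<^bsub>S\<^esub> a) a = ind {e}"
  using assms by (simp_all add: fusion_serfs carrier_S one_S)

lemma fusion_serf_left:
  assumes "a \<in> serfs L" "x \<in> carrier L"
  obtains l where "fusion L a x = ind {l}"
  by (rule left_invertible_single[of a "inv\<^bsub>S\<^esub> a" x])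
    (use assms fusion_inv_serf in simp_all)

lemma fusion_serf_right:
  assumes "a \<in> serfs L" "x \<in> carrier L"
  obtains l where "fusion L x a = ind {l}"
  by (rule right_invertible_single[of a "inv\<^bsub>S\<^esub> a" x])
    (use assms fusion_inv_serf in simp_all)

text \<open>
  If one factor is a serf, the product is a single element. A product of two lords consists of serfs,
  and rotating the triple makes such a serf a factor.
\<close>

lemma multiplicity_free: "fusion L x y = ind (P x y)"
proof (rule ind_floor_set[symmetric])
  fix z
  show "fusion L x y z \<le> 1"
  proof (cases "z \<in> P x y")
    case True
    then have xyz: "x \<in> carrier L" "y \<in> carrier L" "z \<in> carrier L" using P_closed by auto
    consider "x \<in> serfs L" | "y \<in> serfs L" | "z \<in> serfs L"
      using serf_mult_iff[OF True] by blast
    then show ?thesis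
    proof cases
      case 1
      then obtain l where "fusion L x y = ind {l}" using fusion_serf_left xyz by blast
      then show ?thesis by (simp add: ind_def)
    next
      case 2
      then obtain l where "fusion L x y = ind {l}" using fusion_serf_right xyz by blast
      then show ?thesis by (simp add: ind_def)
    next
      case 3
      then have "cj z \<in> serfs L" using conj_serf_iff xyz by simp
      then obtain l where "fusion L y (cj z) = ind {l}" using fusion_serf_right xyz by blast
      then show ?thesis using rotate[OF xyz] by (simp add: ind_def)
    qed
  qed (simp add: floor_set_def)
qed

lemma P_serf_left:
  assumes "a \<in> serfs L" "x \<in> carrier L"
  obtains l where "P a x = {l}" "l \<in> carrier L"
proof -
  obtain l where "fusion L a x = ind {l}" using fusion_serf_left assms .
  then have "P a x = {l}" by simp
  moreover from this have "l \<in> carrier L" using P_closed by blast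
  ultimately show thesis by (rule that)
qed

lemma P_serf_right:
  assumes "a \<in> serfs L" "x \<in> carrier L"
  obtains l where "P x a = {l}" "l \<in> carrier L"
proof -
  obtain l where "fusion L x a = ind {l}" using fusion_serf_right assms .
  then have "P x a = {l}" by simp
  moreover from this have "l \<in> carrier L" using P_closed by blast
  ultimately show thesis by (rule that)
qed

lemma P_inv_serf:
  assumes "a \<in> serfs L"
  shows "P a (inv\<^bsub>S\<^esub> a) = {e}" and "P (inv\<^bsub>S\<^esub> a) a = {e}"
  using fusion_inv_serf[OF assms] by simp_all

section \<open>The stabilizer of the lords\<close>

text \<open>
  Multiply \<open>l\<close> by \<open>m\<close> and its conjugate: the result contains \<open>l\<close>, and bracketed to the right it is \<open>m\<close>
  acted on by serfs.
\<close>

lemma serfs_transitive: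
  assumes "m \<in> lords L" "l \<in> lords L"
  obtains b where "b \<in> serfs L" "P m b = {l}"
proof -
  have "{e} \<bullet> {l} \<subseteq> {m} \<bullet> {cj m} \<bullet> {l}"
    using assms unit_in_P_iff(1)[of m "cj m"] by (intro sp_mono) simp_all
  also have "\<dots> = {m} \<bullet> P (cj m) l"
    using assms by (subst sp_assoc) simp_all
  finally have "l \<in> {m} \<bullet> P (cj m) l" using sp_unit(1)[of "{l}"] assms by simp
  then obtain b where b: "b \<in> P (cj m) l" "l \<in> P m b" by (auto simp: sp_def)
  then have "b \<in> serfs L"
    using serf_mult_iff[OF b(1)] assms conj_lord lord_not_serf by blast
  moreover from P_serf_right[OF \<open>b \<in> serfs L\<close> lord_closed[OF assms(1)]]
  obtain n where "P m b = {n}" by blast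
  ultimately show thesis using that b(2) by auto
qed

text \<open>
  With \<open>n = mb\<close>, the element \<open>l\<close> equal to the inverse of \<open>b\<close> times the conjugate of \<open>m\<close> satisfies
  that \<open>nl\<close> is the product of \<open>m\<close> and its conjugate. This contains the unit, so \<open>l\<close> is the conjugate
  of \<open>n\<close>.
\<close>

lemma conj_serf_action:
  assumes m: "m \<in> lords L" and b: "b \<in> serfs L" and n: "P m b = {n}"
  shows "P n (cj n) = P m (cj m)"
proof -
  have nC: "n \<in> carrier L" using n P_closed by blast
  obtain l where l: "P (inv\<^bsub>S\<^esub> b) (cj m) = {l}" "l \<in> carrier L"
    using P_serf_left[of "inv\<^bsub>S\<^esub> b" "cj m"] b m by auto
  have "P n l = {m} \<bullet> {b} \<bullet> ({inv\<^bsub>S\<^esub> b} \<bullet> {cj m})" using n l by simp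
  also have "\<dots> = {m} \<bullet> ({b} \<bullet> {inv\<^bsub>S\<^esub> b} \<bullet> {cj m})"
    using m b by (simp only: sp_assoc serf_closed lord_closed conj_closed inv_serf
        sp_subset empty_subsetI insert_subset simp_thms)
  also have "\<dots> = P m (cj m)"
    using m b sp_unit(1)[of "{cj m}"] by (simp add: P_inv_serf)
  finally have eq: "P n l = P m (cj m)" .
  then have "l = cj n" using unit_in_P_iff(1) m l(2) nC by (metis conj_closed lord_closed)
  then show ?thesis using eq by simp
qed

text \<open>
  The common stabilizer of all lords on either side, see \<open>K_stabilizes\<close> and \<open>lord_K\<close>; it does not
  depend on the lord chosen here by \<open>K_eq\<close>.
\<close>

definition K :: "'a set" where
  "K = (let m = (SOME m. m \<in> lords L) in P m (cj m))"

text \<open>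
  By transitivity, every lord is a serf multiple of the chosen one. The second equation is the first
  one for the conjugate lord.
\<close>

lemma K_eq:
  assumes "m \<in> lords L"
  shows "P m (cj m) = K" and "P (cj m) m = K"
proof -
  have K: "P n (cj n) = K" if n: "n \<in> lords L" for n
  proof -
    define m0 where "m0 = (SOME m. m \<in> lords L)"
    then have m0: "m0 \<in> lords L" using someI_ex[OF lord_exists] by simp
    obtain b where "b \<in> serfs L" "P m0 b = {n}" using serfs_transitive m0 n .
    then show ?thesis using conj_serf_action m0 by (simp add: K_def m0_def[symmetric])
  qed
  show "P m (cj m) = K" using K assms .
  show "P (cj m) m = K" using K[OF conj_lord[OF assms]] assms by (simp add: conj_conj)
qed

lemma K_serfs: "K \<subseteq> serfs L"
proof -
  obtain m where m: "m \<in> lords L" using lord_exists by blast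
  have "k \<in> serfs L" if "k \<in> P m (cj m)" for k
    using serf_mult_iff[OF that] m conj_lord lord_not_serf by blast
  then show ?thesis using K_eq[OF m] by blast
qed

lemma K_closed [simp]: "K \<subseteq> carrier L"
  using K_serfs by auto

lemma finite_K: "finite K"
  unfolding K_def Let_def by (rule finite_P)

lemma unit_in_K: "e \<in> K"
proof -
  obtain m where m: "m \<in> lords L" using lord_exists by blast
  then show ?thesis using unit_in_P_iff(1)[of m "cj m"] K_eq(1)[OF m] by simp
qed

lemma K_stabilizes:
  assumes m: "m \<in> lords L" and k: "k \<in> K"
  shows "P k m = {m}"
proof -
  have kS: "k \<in> serfs L" using k K_serfs by blast
  obtain n where n: "P (inv\<^bsub>S\<^esub> k) m = {n}" "n \<in> carrier L"
    using P_serf_left[of "inv\<^bsub>S\<^esub> k" m] kS m by auto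
  \<comment> \<open>Bracketed the other way, the product below is \<open>n\<close> times the conjugate of \<open>m\<close>, so \<open>n = m\<close>.\<close>
  have "{e} \<subseteq> {inv\<^bsub>S\<^esub> k} \<bullet> K"
    using k P_inv_serf(2)[OF kS] by (auto simp: sp_def)
  also have "\<dots> = {inv\<^bsub>S\<^esub> k} \<bullet> ({m} \<bullet> {cj m})" using K_eq(1)[OF m] by simp
  also have "\<dots> = {inv\<^bsub>S\<^esub> k} \<bullet> {m} \<bullet> {cj m}" using kS m by (subst sp_assoc) simp_all
  also have "\<dots> = P n (cj m)" using n by simp
  finally have "cj m = cj n" using unit_in_P_iff(1)[OF n(2)] m by simp
  then have "n = m" using conj_conj n(2) m by (metis lord_closed)
  have "P k m = {k} \<bullet> ({inv\<^bsub>S\<^esub> k} \<bullet> {m})" using n \<open>n = m\<close> by simp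
  also have "\<dots> = {k} \<bullet> {inv\<^bsub>S\<^esub> k} \<bullet> {m}" using kS m by (subst sp_assoc) simp_all
  also have "\<dots> = {m}" using kS m sp_unit(1)[of "{m}"] by (simp add: P_inv_serf)
  finally show ?thesis .
qed

lemma K_lord: "m \<in> lords L \<Longrightarrow> K \<bullet> {m} = {m}"
  using K_stabilizes unit_in_K by (auto simp: sp_def)

lemma lord_K:
  assumes m: "m \<in> lords L"
  shows "{m} \<bullet> K = {m}"
proof -
  have "{m} \<bullet> K = {m} \<bullet> ({cj m} \<bullet> {m})" using K_eq(2)[OF m] by simp
  also have "\<dots> = {m} \<bullet> {cj m} \<bullet> {m}" using m by (subst sp_assoc) simp_all
  also have "\<dots> = {m}" using K_eq(1)[OF m] K_lord[OF m] by simp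
  finally show ?thesis .
qed

text \<open>
  As \<open>K\<close> is a lord times its conjugate, whatever fixes the lord is absorbed by \<open>K\<close>.
\<close>

lemma left_absorb:
  assumes "A \<subseteq> carrier L" "m \<in> lords L" "A \<bullet> {m} = {m}"
  shows "A \<bullet> K = K"
proof -
  have "A \<bullet> K = A \<bullet> ({m} \<bullet> {cj m})" using K_eq(1)[OF assms(2)] by simp
  also have "\<dots> = A \<bullet> {m} \<bullet> {cj m}" using assms by (subst sp_assoc) simp_all
  also have "\<dots> = K" using assms(3) K_eq(1)[OF assms(2)] by simp
  finally show ?thesis .
qed

lemma K_K: "K \<bullet> K = K"
  using lord_exists left_absorb K_lord K_closed by blast

lemma singleton_K_K:
  assumes "k \<in> K"
  shows "{k} \<bullet> K = K"
proof -
  obtain m where m: "m \<in> lords L" using lord_exists by blast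
  have "{k} \<subseteq> carrier L" using assms K_closed by blast
  then show ?thesis using left_absorb[OF _ m] K_stabilizes[OF m assms] by simp
qed

text \<open>
  For a serf \<open>x\<close> write \<open>n = xm\<close> with a lord \<open>m\<close>. Since \<open>K\<close> is also \<open>n\<close> times its conjugate, and the
  conjugate of \<open>n\<close> is that of \<open>m\<close> times the inverse of \<open>x\<close>, both sides equal \<open>x\<close> times \<open>m\<close> times the
  conjugate of \<open>m\<close>.
\<close>

lemma K_normal:
  assumes x: "x \<in> carrier L"
  shows "K \<bullet> {x} = {x} \<bullet> K"
proof (cases "x \<in> serfs L")
  case False
  then show ?thesis using x by (simp add: lord_iff[symmetric] K_lord lord_K)
next
  case True
  obtain m where m: "m \<in> lords L" using lord_exists by blast
  obtain n where n: "P x m = {n}" "n \<in> carrier L" using P_serf_left[OF True, of m] m by auto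
  have nM: "n \<in> lords L"
    using serf_mult_iff[of n x m] n(1) True lord_not_serf[OF m] lord_iff[OF n(2)] by simp
  obtain l where l: "P (cj m) (inv\<^bsub>S\<^esub> x) = {l}" "l \<in> carrier L"
    using P_serf_right[of "inv\<^bsub>S\<^esub> x" "cj m"] True m by auto
  have "P l n = {cj m} \<bullet> {inv\<^bsub>S\<^esub> x} \<bullet> ({x} \<bullet> {m})" using n l by simp
  also have "\<dots> = {cj m} \<bullet> ({inv\<^bsub>S\<^esub> x} \<bullet> {x} \<bullet> {m})"
    using m True x by (simp only: sp_assoc serf_closed lord_closed conj_closed inv_serf
        sp_subset empty_subsetI insert_subset simp_thms)
  also have "\<dots> = P (cj m) m" using m True sp_unit(1)[of "{m}"] by (simp add: P_inv_serf)
  finally have "e \<in> P l n" using unit_in_K K_eq(2)[OF m] by simp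
  then have "l = cj n" using unit_in_P_iff(2)[OF n(2) l(2)] by simp
  have "P (cj n) x = {cj m} \<bullet> {inv\<^bsub>S\<^esub> x} \<bullet> {x}" using l \<open>l = cj n\<close> by simp
  also have "\<dots> = {cj m} \<bullet> ({inv\<^bsub>S\<^esub> x} \<bullet> {x})" using m True x by (subst sp_assoc) simp_all
  also have "\<dots> = {cj m}" using m True sp_unit(2)[of "{cj m}"] by (simp add: P_inv_serf)
  finally have cjn: "P (cj n) x = {cj m}" .
  have "K \<bullet> {x} = {n} \<bullet> {cj n} \<bullet> {x}" using K_eq(1)[OF nM] by simp
  also have "\<dots> = {n} \<bullet> ({cj n} \<bullet> {x})" using n x by (subst sp_assoc) simp_all
  also have "\<dots> = {x} \<bullet> {m} \<bullet> {cj m}" using cjn n by simp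
  also have "\<dots> = {x} \<bullet> ({m} \<bullet> {cj m})" using x m by (subst sp_assoc) simp_all
  also have "\<dots> = {x} \<bullet> K" using K_eq(1)[OF m] by simp
  finally show ?thesis .
qed

section \<open>The group of cosets\<close>

definition \<pi> :: "'a \<Rightarrow> 'a set" where
  "\<pi> x = {x} \<bullet> K"

lemma pi_closed [simp]: "\<pi> x \<subseteq> carrier L"
  by (simp add: \<pi>_def)

lemma pi_lord: "m \<in> lords L \<Longrightarrow> \<pi> m = {m}"
  by (simp add: \<pi>_def lord_K)

lemma pi_K: "k \<in> K \<Longrightarrow> \<pi> k = K"
  by (simp add: \<pi>_def singleton_K_K)

lemma self_in_pi:
  assumes "x \<in> carrier L"
  shows "x \<in> \<pi> x"
proof -
  have "{x} \<bullet> {e} \<subseteq> \<pi> x" unfolding \<pi>_def using unit_in_K by (intro sp_mono) simp_all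
  then show ?thesis using sp_unit(2)[of "{x}"] assms by simp
qed

lemma pi_sp_K: "x \<in> carrier L \<Longrightarrow> \<pi> x \<bullet> K = \<pi> x"
  by (simp add: \<pi>_def sp_assoc K_K)

lemma K_sp_pi:
  assumes "x \<in> carrier L"
  shows "K \<bullet> \<pi> x = \<pi> x"
proof -
  have "K \<bullet> \<pi> x = K \<bullet> {x} \<bullet> K" unfolding \<pi>_def using assms by (subst sp_assoc) simp_all
  also have "\<dots> = \<pi> x" using K_normal[OF assms] pi_sp_K[OF assms] by (simp add: \<pi>_def)
  finally show ?thesis .
qed

lemma pi_eq_of_mem:
  assumes x: "x \<in> carrier L" and z: "z \<in> \<pi> x"
  shows "\<pi> z = \<pi> x"
proof -
  obtain k where k: "k \<in> K" "z \<in> P x k" using z by (auto simp: \<pi>_def sp_def)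
  then have kS: "k \<in> serfs L" using K_serfs by blast
  obtain l where "P x k = {l}" using P_serf_right[OF kS x] .
  then have "P x k = {z}" using k(2) by auto
  then have "\<pi> z = {x} \<bullet> {k} \<bullet> K" by (simp add: \<pi>_def)
  also have "\<dots> = {x} \<bullet> ({k} \<bullet> K)" using x kS by (subst sp_assoc) simp_all
  also have "\<dots> = \<pi> x" using singleton_K_K[OF k(1)] by (simp add: \<pi>_def)
  finally show ?thesis .
qed

text \<open>
  A product with one lord is a single lord. For two lords write \<open>y\<close> as the conjugate of \<open>x\<close> times a
  serf \<open>b\<close>; then \<open>xy = Kb\<close> is a coset.
\<close>

lemma P_eq_pi:
  assumes x: "x \<in> carrier L" and y: "y \<in> carrier L" and xy: "x \<notin> serfs L \<or> y \<notin> serfs L"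
    and z: "z \<in> P x y"
  shows "P x y = \<pi> z"
proof (cases "x \<in> serfs L \<or> y \<in> serfs L")
  case True
  have zC: "z \<in> carrier L" using P_closed z by blast
  have "z \<in> lords L" using serf_mult_iff[OF z] True xy zC lord_iff by blast
  moreover have "P x y = {z}"
    using True
  proof
    assume "x \<in> serfs L"
    then obtain l where "P x y = {l}" using P_serf_left y by blast
    then show ?thesis using z by auto
  next
    assume "y \<in> serfs L"
    then obtain l where "P x y = {l}" using P_serf_right x by blast
    then show ?thesis using z by auto
  qed
  ultimately show ?thesis by (simp add: pi_lord)
next
  case False
  then have xM: "x \<in> lords L" and yM: "y \<in> lords L" using x y lord_iff by simp_all
  obtain b where b: "b \<in> serfs L" "P (cj x) b = {y}"
    using serfs_transitive[OF conj_lord[OF xM] yM] .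
  have "P x y = {x} \<bullet> ({cj x} \<bullet> {b})" using b by simp
  also have "\<dots> = {x} \<bullet> {cj x} \<bullet> {b}" using x b by (subst sp_assoc) simp_all
  also have "\<dots> = \<pi> b" using K_eq(1)[OF xM] K_normal[of b] b by (simp add: \<pi>_def)
  finally have "P x y = \<pi> b" .
  then show ?thesis using pi_eq_of_mem[of b z] z b by simp
qed

lemma pi_mult:
  assumes z: "z \<in> P x y"
  shows "\<pi> x \<bullet> \<pi> y = \<pi> z"
proof -
  have xyz: "x \<in> carrier L" "y \<in> carrier L" "z \<in> carrier L" using P_closed[OF z] by auto
  have "\<pi> x \<bullet> \<pi> y = {x} \<bullet> (K \<bullet> \<pi> y)" unfolding \<pi>_def[of x] using xyz by (subst sp_assoc) simp_all
  also have "\<dots> = {x} \<bullet> ({y} \<bullet> K)" using K_sp_pi xyz by (simp add: \<pi>_def)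
  also have "\<dots> = {x} \<bullet> {y} \<bullet> K" using xyz by (subst sp_assoc) simp_all
  also have "\<dots> = \<pi> z"
  proof (cases "x \<in> serfs L \<and> y \<in> serfs L")
    case True
    then have "P x y = {z}" using z P_serfs by auto
    then show ?thesis by (simp add: \<pi>_def)
  next
    case False
    then have "P x y = \<pi> z" using P_eq_pi xyz z by blast
    then show ?thesis using pi_sp_K xyz(3) by simp
  qed
  finally show ?thesis .
qed

text \<open>
  The universal grading group of \<open>L\<close>, built from products of sets, which are associative from the
  outset.
\<close>

definition coset_group :: "'a set monoid" where
  "coset_group = \<lparr>carrier = \<pi> ` carrier L,
     mult = (\<lambda>X Y. if X \<in> \<pi> ` carrier L \<and> Y \<in> \<pi> ` carrier L then X \<bullet> Y else undefined),
     one = K\<rparr>"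

lemma carrier_coset_group: "carrier coset_group = \<pi> ` carrier L"
  and one_coset_group: "\<one>\<^bsub>coset_group\<^esub> = K"
  by (simp_all add: coset_group_def)

lemma mult_coset_group:
  "\<lbrakk>x \<in> carrier L; y \<in> carrier L\<rbrakk> \<Longrightarrow> \<pi> x \<otimes>\<^bsub>coset_group\<^esub> \<pi> y = \<pi> x \<bullet> \<pi> y"
  by (simp add: coset_group_def)

lemma pi_mult_coset_group:
  assumes "z \<in> P x y"
  shows "\<pi> x \<otimes>\<^bsub>coset_group\<^esub> \<pi> y = \<pi> z"
  using pi_mult[OF assms] P_closed[OF assms] by (simp add: mult_coset_group)

lemma group_coset_group: "group coset_group"
proof (rule groupI)
  have mult: "\<pi> x \<otimes>\<^bsub>coset_group\<^esub> \<pi> y \<in> carrier coset_group"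
    if "x \<in> carrier L" "y \<in> carrier L" for x y
  proof -
    from P_nonempty[OF that] obtain z where z: "z \<in> P x y" by blast
    then show ?thesis using pi_mult_coset_group[OF z] P_closed by (auto simp: carrier_coset_group)
  qed
  then show "X \<otimes>\<^bsub>coset_group\<^esub> Y \<in> carrier coset_group"
    if "X \<in> carrier coset_group" "Y \<in> carrier coset_group" for X Y
    using that by (auto simp: carrier_coset_group)
  show "\<one>\<^bsub>coset_group\<^esub> \<in> carrier coset_group"
    using pi_K[OF unit_in_K] unit_closed unfolding carrier_coset_group one_coset_group by blast
  fix X assume "X \<in> carrier coset_group"
  then obtain x where x: "x \<in> carrier L" "X = \<pi> x" by (auto simp: carrier_coset_group)
  show "\<one>\<^bsub>coset_group\<^esub> \<otimes>\<^bsub>coset_group\<^esub> X = X"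
    using x mult_coset_group[of e x] by (simp add: one_coset_group pi_K[OF unit_in_K] K_sp_pi)
  have "e \<in> P (cj x) x" using unit_in_P_iff(2)[of x "cj x"] x by simp
  then have "\<pi> (cj x) \<otimes>\<^bsub>coset_group\<^esub> X = \<one>\<^bsub>coset_group\<^esub>"
    using pi_mult_coset_group x by (simp add: one_coset_group pi_K[OF unit_in_K])
  then show "\<exists>Y\<in>carrier coset_group. Y \<otimes>\<^bsub>coset_group\<^esub> X = \<one>\<^bsub>coset_group\<^esub>"
    using x by (auto simp: carrier_coset_group)
  fix Y Z assume "Y \<in> carrier coset_group" "Z \<in> carrier coset_group"
  then obtain y z where y: "y \<in> carrier L" "Y = \<pi> y" and z: "z \<in> carrier L" "Z = \<pi> z"
    by (auto simp: carrier_coset_group)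
  have mem: "\<pi> x \<bullet> \<pi> y \<in> \<pi> ` carrier L" "\<pi> y \<bullet> \<pi> z \<in> \<pi> ` carrier L"
    using mult[OF x(1) y(1)] mult[OF y(1) z(1)] x y z
    by (simp_all add: mult_coset_group carrier_coset_group)
  then have "X \<otimes>\<^bsub>coset_group\<^esub> Y \<otimes>\<^bsub>coset_group\<^esub> Z = \<pi> x \<bullet> \<pi> y \<bullet> \<pi> z"
    "X \<otimes>\<^bsub>coset_group\<^esub> (Y \<otimes>\<^bsub>coset_group\<^esub> Z) = \<pi> x \<bullet> (\<pi> y \<bullet> \<pi> z)"
    using x y z by (simp_all add: coset_group_def)
  then show "X \<otimes>\<^bsub>coset_group\<^esub> Y \<otimes>\<^bsub>coset_group\<^esub> Z = X \<otimes>\<^bsub>coset_group\<^esub> (Y \<otimes>\<^bsub>coset_group\<^esub> Z)"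
    by (simp add: sp_assoc)
qed

definition serf_hom :: "'a hobj" where
  "serf_hom = \<lparr>src = S, tgt = coset_group, hmap = restrict \<pi> (serfs L)\<rparr>"

lemma serf_hom_simps [simp]: "src serf_hom = S" "tgt serf_hom = coset_group"
    "a \<in> serfs L \<Longrightarrow> hmap serf_hom a = \<pi> a"
  by (simp_all add: serf_hom_def)

lemma him_serf_hom: "him serf_hom = \<pi> ` serfs L"
  by (simp add: him_def carrier_S)

lemma pi_in_him_iff:
  assumes "x \<in> carrier L"
  shows "\<pi> x \<in> \<pi> ` serfs L \<longleftrightarrow> x \<in> serfs L"
proof
  assume "\<pi> x \<in> \<pi> ` serfs L"
  then obtain a where a: "a \<in> serfs L" "\<pi> x = \<pi> a" by blast
  then obtain k where k: "k \<in> K" "x \<in> P a k"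
    using self_in_pi[OF assms] by (auto simp: \<pi>_def sp_def)
  then show "x \<in> serfs L" using serf_mult_iff[OF k(2)] a(1) K_serfs by blast
qed blast

lemma kernel_serf_hom: "kernel S coset_group (hmap serf_hom) = K"
proof -
  have "a \<in> K" if "a \<in> serfs L" "\<pi> a = K" for a
    using self_in_pi[of a] that by simp
  then show ?thesis
    using K_serfs pi_K by (auto simp: kernel_def carrier_S one_coset_group)
qed

lemma hobject_serf_hom: "hobject serf_hom"
proof -
  interpret G: group coset_group by (rule group_coset_group)
  have hom: "hmap serf_hom \<in> hom S coset_group"
  proof (rule homI)
    fix a b assume ab: "a \<in> carrier S" "b \<in> carrier S"
    then have "a \<in> serfs L" "b \<in> serfs L" "a \<otimes>\<^bsub>S\<^esub> b \<in> serfs L"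
      using S.m_closed[OF ab] by (simp_all add: carrier_S)
    then show "hmap serf_hom (a \<otimes>\<^bsub>S\<^esub> b) = hmap serf_hom a \<otimes>\<^bsub>coset_group\<^esub> hmap serf_hom b"
      using pi_mult_coset_group[of "a \<otimes>\<^bsub>S\<^esub> b" a b] by (simp add: P_serfs)
  qed (auto simp: carrier_S carrier_coset_group)
  interpret u: group_hom S coset_group "hmap serf_hom"
    by unfold_locales (fact hom)
  have sub: "subgroup (him serf_hom) coset_group"
    using u.img_is_subgroup by (simp add: him_def)
  have outsider: "\<exists>m\<in>lords L. X = {m} \<and> X = \<pi> m" if X: "X \<in> carrier coset_group - him serf_hom" for X
  proof -
    obtain x where x: "x \<in> carrier L" "X = \<pi> x" using X by (auto simp: carrier_coset_group)
    then have "x \<in> lords L" using X pi_in_him_iff lord_iff by (auto simp: him_serf_hom)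
    then show ?thesis using x pi_lord by auto
  qed
  obtain m where m: "m \<in> lords L" using lord_exists by blast
  then have "\<pi> m \<notin> him serf_hom" using pi_in_him_iff[of m] lord_not_serf[of m] by (simp add: him_serf_hom)
  then have "him serf_hom \<noteq> carrier coset_group" using m by (auto simp: carrier_coset_group)
  moreover have "X \<otimes>\<^bsub>coset_group\<^esub> Y \<in> him serf_hom"
    if "X \<in> carrier coset_group - him serf_hom" "Y \<in> carrier coset_group - him serf_hom" for X Y
  proof -
    from outsider[OF that(1)] outsider[OF that(2)]
    obtain l n where ln: "l \<in> lords L" "n \<in> lords L" "X = \<pi> l" "Y = \<pi> n" by blast
    obtain z where z: "z \<in> P l n" using P_nonempty[of l n] ln by auto
    have "z \<in> serfs L" using serf_mult_iff[OF z] ln lord_not_serf by blast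
    then show ?thesis using pi_mult_coset_group[OF z] ln by (simp add: him_serf_hom)
  qed
  ultimately have "card (rcosets\<^bsub>coset_group\<^esub> (him serf_hom)) = 2"
    using G.card_rcosets_eq_2_iff[OF sub] by blast
  moreover have "ext_mult coset_group"
    by (auto simp: ext_mult_def coset_group_def)
  moreover have "hmap serf_hom \<in> extensional (carrier S)"
    by (simp add: serf_hom_def carrier_S)
  moreover have "\<forall>X \<in> carrier coset_group - him serf_hom. \<exists>m. m \<notin> carrier S \<and> X = {m}"
  proof
    fix X assume "X \<in> carrier coset_group - him serf_hom"
    then obtain m where "m \<in> lords L" "X = {m}" using outsider by blast
    then show "\<exists>m. m \<notin> carrier S \<and> X = {m}" using lord_not_serf by (auto simp: carrier_S)
  qed
  moreover have "hmap serf_hom a = K #>\<^bsub>S\<^esub> a" if "a \<in> carrier S" for a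
  proof -
    have a: "a \<in> serfs L" using that by (simp add: carrier_S)
    have "K #>\<^bsub>S\<^esub> a = K \<bullet> {a}"
    proof -
      have "P k a = {k \<otimes>\<^bsub>S\<^esub> a}" if "k \<in> K" for k
        using that a K_serfs P_serfs by blast
      then show ?thesis by (simp add: r_coset_def sp_def)
    qed
    then show ?thesis using a K_normal by (simp add: \<pi>_def)
  qed
  ultimately show ?thesis
    using S.group_axioms G.group_axioms ext_S hom finite_K
    by (simp add: hobject_def kernel_serf_hom)
qed

text \<open>
  The fusion of \<open>\<Phi>\<close> at \<open>serf_hom\<close> is a product of cosets as soon as a lord is involved, and so is
  that of \<open>L\<close> by \<open>P_eq_pi\<close>; on serfs both are the product of the serf group.
\<close>

lemma Phi_serf_hom: "Phi_ob serf_hom = L"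
proof -
  interpret H: index_two_hom serf_hom by unfold_locales (rule hobject_serf_hom)
  have "hlords serf_hom = lords L"
  proof (intro Set.set_eqI iffI)
    fix m assume "m \<in> hlords serf_hom"
    then have m: "{m} \<in> \<pi> ` carrier L" "{m} \<notin> \<pi> ` serfs L"
      by (simp_all add: hlords_def carrier_coset_group him_serf_hom)
    then obtain x where x: "x \<in> carrier L" "{m} = \<pi> x" by blast
    then have "x \<in> lords L" using m lord_iff by auto
    then show "m \<in> lords L" using x pi_lord by simp
  next
    fix m assume m: "m \<in> lords L"
    then have pi_m: "\<pi> m = {m}" "\<pi> m \<notin> \<pi> ` serfs L" using pi_lord pi_in_him_iff[of m] lord_not_serf[of m] by simp_all
    moreover have "\<pi> m \<in> \<pi> ` carrier L" using m by (intro imageI) simp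
    ultimately show "m \<in> hlords serf_hom"
      by (simp add: hlords_def carrier_coset_group him_serf_hom)
  qed
  then have C: "carrier (Phi_ob serf_hom) = carrier L"
    by (simp add: H.carrier_L carrier_S carrier_split)
  have proj: "proj serf_hom x = \<pi> x" if "x \<in> carrier L" for x
    using that pi_lord lord_iff by (simp add: proj_def carrier_S)
  have "fusion (Phi_ob serf_hom) x y = fusion L x y" for x y
  proof (cases "x \<in> carrier L \<and> y \<in> carrier L")
    case True
    then have xy: "x \<in> carrier L" "y \<in> carrier L" by simp_all
    have "H.prod_set x y = P x y"
    proof (cases "x \<in> serfs L \<and> y \<in> serfs L")
      case True
      then show ?thesis by (simp add: H.prod_set_serfs carrier_S P_serfs)
    next
      case False
      obtain z where z: "z \<in> P x y" using P_nonempty[OF xy] by blast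
      have "H.prod_set x y = \<pi> x \<otimes>\<^bsub>coset_group\<^esub> \<pi> y"
        using False xy by (auto simp: H.prod_set_def carrier_S proj)
      then show ?thesis using pi_mult_coset_group[OF z] P_eq_pi[OF xy _ z] False by simp
    qed
    then show ?thesis using H.fusion_L[of x y] multiplicity_free[of x y] xy C by simp
  next
    case False
    then have "P x y = {}" using P_closed by blast
    then show ?thesis using False H.fusion_L_outside[of x y] multiplicity_free[of x y] C by simp
  qed
  moreover have "grade (Phi_ob serf_hom) = grade L"
  proof (rule extensionalityI)
    show "grade (Phi_ob serf_hom) \<in> extensional (carrier L)"
      using C by (simp add: Phi_ob_def)
    show "grade L \<in> extensional (carrier L)"
      using feudal_rule by (simp add: feudal_rule_def)
    fix x assume "x \<in> carrier L"
    then show "grade (Phi_ob serf_hom) x = grade L x"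
      using H.grade_L[of x] grade_values[of x] serf_iff_grade[of x] C by (auto simp: carrier_S)
  qed
  ultimately show ?thesis using C by (intro feudal.equality ext) simp_all
qed

end

section \<open>The isomorphism of categories\<close>

lemma mutually_inverse_Phi_Gamma:
  "mutually_inverse_isos (catH :: ('a hobj, ('a \<Rightarrow> 'a) \<times> ('a set \<Rightarrow> 'a set)) cat)
    (catL :: ('a feudal, 'a \<Rightarrow> 'a) cat) Phi Gamma"
proof (rule mutually_inverse_isosI[OF is_functor_Phi _ _ _ _ category_catH])
  fix X :: "'a hobj" assume "X \<in> Ob catH"
  then interpret index_two_hom X by unfold_locales (simp add: catH_def)
  show "on_ob Gamma (on_ob Phi X) = X"
    using Gamma_Phi_ob by (simp add: Phi_def Gamma_def)
next
  fix L :: "'a feudal" assume "L \<in> Ob catL"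
  then interpret feudal_structure L by unfold_locales (simp add: catL_def)
  show "\<exists>X\<in>Ob catH. on_ob Phi X = L"
    using hobject_serf_hom Phi_serf_hom by (auto simp: catH_def Phi_def)
next
  fix X Y :: "'a hobj" and f
  assume "X \<in> Ob catH" "Y \<in> Ob catH" and f: "f \<in> Hom catH X Y"
  then interpret index_two_hom_pair X Y by unfold_locales (simp_all add: catH_def)
  show "on_hom Gamma (on_ob Phi X) (on_ob Phi Y) (on_hom Phi X Y f) = f"
    using Gamma_Phi_hom f by (simp add: Phi_def Gamma_def catH_def)
next
  fix X Y :: "'a hobj" and t
  assume "X \<in> Ob catH" "Y \<in> Ob catH" and "t \<in> Hom catL (on_ob Phi X) (on_ob Phi Y)"
  then have t: "t \<in> graded_hom (Phi_ob X) (Phi_ob Y)" and "hobject X" "hobject Y"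
    by (simp_all add: catL_def catH_def Phi_def)
  then interpret index_two_hom_pair X Y by unfold_locales
  show "\<exists>f\<in>Hom catH X Y. on_hom Phi X Y f = t"
    using Gamma_hom_hmorphism[OF t] Phi_Gamma_hom[OF t] by (auto simp: Phi_def catH_def)
qed

theorem theorem2:
  shows "category (catL :: ('a feudal, 'a \<Rightarrow> 'a) cat)
    \<and> category (catH :: ('a hobj, ('a \<Rightarrow> 'a) \<times> ('a set \<Rightarrow> 'a set)) cat)
    \<and> mutually_inverse_isos
        (catH :: ('a hobj, ('a \<Rightarrow> 'a) \<times> ('a set \<Rightarrow> 'a set)) cat)
        (catL :: ('a feudal, 'a \<Rightarrow> 'a) cat) Phi Gamma
    \<and> isomorphic_cats
        (catL :: ('a feudal, 'a \<Rightarrow> 'a) cat)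
        (catH :: ('a hobj, ('a \<Rightarrow> 'a) \<times> ('a set \<Rightarrow> 'a set)) cat)"
  using category_catL category_catH mutually_inverse_Phi_Gamma
    mutually_inverse_isos_sym[OF mutually_inverse_Phi_Gamma]
  unfolding isomorphic_cats_def by blast

end
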